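(* Let $\{M^{(n)}\}_{n\in\mathbb{N}}\subset\mathcal{M}_\infty$ and $M\in\mathcal{M}_\infty$. If $M^{(n)}_\infty\to M_\infty$ in $L^1$ as $n\to\infty$, then $$\left[M^{(n)}-M\right]_\infty\longrightarrow 0\quad\text{in probability as } n\to\infty.$$ Moreover, if $M^{(n)}_\infty\to M_\infty$ in $L^1$ as $n\to\infty$, then for every $t\ge 0$ $$\left[M^{(n)}-M\right]_t\longrightarrow 0\quad\text{in probability as } n\to\infty.$$
   Context: The setting is a general filtered probability space $(\Omega,\mathcal{F},\{\mathcal{F}_t\}_{t\in\mathbb{R}_+},\mathbb{P})$. $\mathcal{M}_\infty$ denotes the class of càdlàg uniformly integrable martingales, $M_\infty$ is the terminal value (limit as $t\to\infty$) of $M\in\mathcal{M}_\infty$, and $[\,\cdot\,]$ denotes the quadratic variation process, with $[N]_\infty=\lim_{t\to\infty}[N]_t$. Convergence in probability is under $\mathbb{P}$ and $L^1=L^1(\mathbb{P})$. *)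

theory Defs
  imports "HOL-Probability.Probability"
begin

text \<open>
  Time is the half-line \<open>[0,\<infinity>)\<close>: processes and filtrations are indexed by \<^typ>\<open>real\<close>, and
  nothing is said about their values at negative times.  The filtration is neither assumed
  complete nor right-continuous.
\<close>

locale filtered_prob_space = prob_space P
  for P :: "'a measure" +
  fixes F :: "real \<Rightarrow> 'a measure"
  assumes subalgebra_filtration: "0 \<le> t \<Longrightarrow> subalgebra P (F t)"
    and filtration_mono: "0 \<le> s \<Longrightarrow> s \<le> t \<Longrightarrow> subalgebra (F t) (F s)"

definition cadlag_on :: "'a set \<Rightarrow> (real \<Rightarrow> 'a \<Rightarrow> real) \<Rightarrow> bool" where
  "cadlag_on \<Omega> X \<longleftrightarrow> (\<forall>\<omega>\<in>\<Omega>.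
     (\<forall>t\<ge>0. ((\<lambda>s. X s \<omega>) \<longlongrightarrow> X t \<omega>) (at_right t)) \<and>
     (\<forall>t>0. \<exists>l. ((\<lambda>s. X s \<omega>) \<longlongrightarrow> l) (at_left t)))"

definition martingale :: "'a measure \<Rightarrow> (real \<Rightarrow> 'a measure) \<Rightarrow> (real \<Rightarrow> 'a \<Rightarrow> real) \<Rightarrow> bool" where
  "martingale P F X \<longleftrightarrow>
     (\<forall>t\<ge>0. X t \<in> borel_measurable (F t) \<and> integrable P (X t)) \<and>
     (\<forall>s\<ge>0. \<forall>t\<ge>s. AE \<omega> in P. real_cond_exp P (F s) (X t) \<omega> = X s \<omega>)"

definition unif_integrable :: "'a measure \<Rightarrow> (real \<Rightarrow> 'a \<Rightarrow> real) \<Rightarrow> bool" where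
  "unif_integrable P X \<longleftrightarrow>
     (\<forall>t\<ge>0. integrable P (X t)) \<and>
     (\<forall>\<epsilon>>0. \<exists>K. \<forall>t\<ge>0. (LINT \<omega>:{\<omega>\<in>space P. K < \<bar>X t \<omega>\<bar>}|P. \<bar>X t \<omega>\<bar>) \<le> \<epsilon>)"

definition UI_martingales :: "'a measure \<Rightarrow> (real \<Rightarrow> 'a measure) \<Rightarrow> (real \<Rightarrow> 'a \<Rightarrow> real) set" where
  "UI_martingales P F = {X. martingale P F X \<and> cadlag_on (space P) X \<and> unif_integrable P X}"

text \<open>
  By martingale convergence the limit below exists almost surely for a uniformly integrable
  cadlag martingale; on the remaining null event it is a fixed unspecified real.
\<close>
definition terminal_value :: "(real \<Rightarrow> 'a \<Rightarrow> real) \<Rightarrow> 'a \<Rightarrow> real" where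
  "terminal_value X \<omega> = Lim at_top (\<lambda>t. X t \<omega>)"

definition tendsto_L1 :: "'a measure \<Rightarrow> (nat \<Rightarrow> 'a \<Rightarrow> real) \<Rightarrow> ('a \<Rightarrow> real) \<Rightarrow> bool" where
  "tendsto_L1 P X Y \<longleftrightarrow> (\<lambda>n. \<integral>\<^sup>+\<omega>. ennreal \<bar>X n \<omega> - Y \<omega>\<bar> \<partial>P) \<longlonglongrightarrow> 0"

text \<open>
  The variables \<open>X n\<close> may take the values \<open>\<plusminus>\<infinity>\<close>, as \<open>[N]\<^sub>\<infinity>\<close> is a priori only extended-real-valued;
  the limit \<open>Y\<close> is finite, so the difference is meaningful.
\<close>
definition tendsto_in_prob :: "'a measure \<Rightarrow> (nat \<Rightarrow> 'a \<Rightarrow> ereal) \<Rightarrow> ('a \<Rightarrow> real) \<Rightarrow> bool" where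
  "tendsto_in_prob P X Y \<longleftrightarrow>
     (\<forall>n. X n \<in> borel_measurable P) \<and> Y \<in> borel_measurable P \<and>
     (\<forall>\<epsilon>>0. (\<lambda>n. measure P {\<omega>\<in>space P. ereal \<epsilon> < \<bar>X n \<omega> - ereal (Y \<omega>)\<bar>}) \<longlonglongrightarrow> 0)"

text \<open>
  A partition \<open>0 = p 0 < \<dots> < p k = t\<close> of \<open>[0,t]\<close>.
\<close>
definition partition_of :: "real \<Rightarrow> nat \<Rightarrow> (nat \<Rightarrow> real) \<Rightarrow> bool" where
  "partition_of t k p \<longleftrightarrow> p 0 = 0 \<and> p k = t \<and> (\<forall>i<k. p i < p (Suc i))"

text \<open>The inserted \<open>0\<close> only matters for the one-point partition of \<open>[0,0]\<close>.\<close>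
definition mesh :: "nat \<Rightarrow> (nat \<Rightarrow> real) \<Rightarrow> real" where
  "mesh k p = Max (insert 0 ((\<lambda>i. p (Suc i) - p i) ` {..<k}))"

text \<open>
  The initial value contributes \<open>X\<^sub>0\<^sup>2\<close> (the convention \<open>\<Delta>X\<^sub>0 = X\<^sub>0\<close>).
\<close>
definition square_sum :: "(real \<Rightarrow> 'a \<Rightarrow> real) \<Rightarrow> nat \<Rightarrow> (nat \<Rightarrow> real) \<Rightarrow> 'a \<Rightarrow> real" where
  "square_sum X k p \<omega> = (X 0 \<omega>)\<^sup>2 + (\<Sum>i<k. (X (p (Suc i)) \<omega> - X (p i) \<omega>)\<^sup>2)"

text \<open>
  \<open>Q\<close> is (a version of) the quadratic variation process \<open>[X]\<close>: a process with nondecreasing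
  right-continuous paths such that, for every \<open>t\<close>, the sums of squared increments of \<open>X\<close> along any
  sequence of partitions of \<open>[0,t]\<close> with mesh tending to \<open>0\<close> converge to \<open>Q t\<close> in probability.
  This determines \<open>Q\<close> up to indistinguishability, and every cadlag martingale has such a \<open>Q\<close>;
  being a limit of adapted sums, it is adapted up to null sets, so that is not required separately.
\<close>
definition is_quadratic_variation ::
    "'a measure \<Rightarrow> (real \<Rightarrow> 'a \<Rightarrow> real) \<Rightarrow> (real \<Rightarrow> 'a \<Rightarrow> real) \<Rightarrow> bool" where
  "is_quadratic_variation P X Q \<longleftrightarrow>
     (\<forall>t\<ge>0. Q t \<in> borel_measurable P) \<and>
     (\<forall>\<omega>\<in>space P. mono_on {0..} (\<lambda>t. Q t \<omega>)) \<and>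
     cadlag_on (space P) Q \<and>
     (\<forall>t\<ge>0. \<forall>k p.
        (\<forall>m. partition_of t (k m) (p m)) \<longrightarrow> (\<lambda>m. mesh (k m) (p m)) \<longlonglongrightarrow> 0 \<longrightarrow>
        tendsto_in_prob P (\<lambda>m \<omega>. ereal (square_sum X (k m) (p m) \<omega>)) (Q t))"

text \<open>
  The limit \<open>[N]\<^sub>\<infinity>\<close> is taken in the extended reals, where it exists on every path by monotonicity.
\<close>
definition qv_infinity :: "(real \<Rightarrow> 'a \<Rightarrow> real) \<Rightarrow> 'a \<Rightarrow> ereal" where
  "qv_infinity Q \<omega> = Lim at_top (\<lambda>t. ereal (Q t \<omega>))"

end

theory Submission
  imports Defs
begin

text \<open>
  The core is Burkholder's weak-type bound \<open>c P(S > c) \<le> 3 E|f\<^sub>k|\<close> for the square function \<open>S\<close> of a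
  discrete martingale \<open>f\<close>.  Let \<open>h\<close> be the Huber function, equal to \<open>x\<^sup>2\<close> for \<open>|x| \<le> c\<close> and
  continued linearly.  It is convex and \<open>0 \<le> h x \<le> 2c|x|\<close>; its Bregman divergence
  \<open>h y - h x - h'(x)(y - x)\<close> is nonnegative, and equals \<open>(y - x)\<^sup>2\<close> when \<open>|x|, |y| \<le> c\<close>.  Since \<open>h'\<close> is
  bounded, the linear term has mean zero along a martingale, so telescoping gives
  \<open>E(S\<^sup>2; max |f\<^sub>i| \<le> c) \<le> E h(f\<^sub>k) \<le> 2c E|f\<^sub>k|\<close>, while Doob's maximal inequality bounds \<open>P(max |f\<^sub>i| > c)\<close>.
  Passing to the limit along partitions, \<open>P(|[N]\<^sub>t| > \<epsilon>) \<le> 3 E|N\<^sub>t| / \<surd>(\<epsilon>/2)\<close>.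

  It remains to see \<open>E|N\<^sub>t| \<le> E|N\<^sub>\<infinity>|\<close>, which requires that a uniformly integrable martingale
  converges to its terminal value almost surely and in \<open>L\<^sup>1\<close>.  The same function \<open>h\<close> replaces upcrossings:
  \<open>E h(X\<^sub>t)\<close> is bounded and nondecreasing in \<open>t\<close>, hence \<open>E((X\<^sub>t - X\<^sub>s)\<^sup>2; |X\<^sub>s|, |X\<^sub>t| \<le> c)\<close> is small for
  large \<open>s \<le> t\<close>, and with uniform integrability \<open>X\<close> is Cauchy in \<open>L\<^sup>1\<close>.  The maximal inequality on
  dyadic times after \<open>s\<close> turns this into almost sure convergence.
\<close>

subsection \<open>The Huber function\<close>

definition huber :: "real \<Rightarrow> real \<Rightarrow> real" where
  "huber c x = (if \<bar>x\<bar> \<le> c then x\<^sup>2 else 2 * c * \<bar>x\<bar> - c\<^sup>2)"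

text \<open>Twice the projection of \<open>x\<close> onto \<open>[-c, c]\<close>. This form makes
  the bound \<open>2 * c\<close> immediate and exhibits the point \<open>z\<close> used in
  \<open>huber_tangent\<close>.\<close>

definition huber_deriv :: "real \<Rightarrow> real \<Rightarrow> real" where
  "huber_deriv c x = 2 * max (- c) (min c x)"

lemma huber_nonneg: "0 \<le> c \<Longrightarrow> 0 \<le> huber c x"
proof -
  assume c: "0 \<le> c"
  have "c * c \<le> 2 * c * \<bar>x\<bar>" if "c \<le> \<bar>x\<bar>"
    using mult_left_mono[OF that c] c mult_nonneg_nonneg[OF c abs_ge_zero[of x]] by linarith
  then show ?thesis
    by (auto simp: huber_def power2_eq_square)
qed

lemma huber_le: "0 \<le> c \<Longrightarrow> huber c x \<le> 2 * c * \<bar>x\<bar>"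
proof -
  assume c: "0 \<le> c"
  have "x * x \<le> 2 * c * \<bar>x\<bar>" if "\<bar>x\<bar> \<le> c"
    using mult_right_mono[OF that abs_ge_zero[of x]] mult_nonneg_nonneg[OF c abs_ge_zero[of x]] by simp
  then show ?thesis
    by (auto simp: huber_def power2_eq_square)
qed

lemma huber_deriv_bound: "0 \<le> c \<Longrightarrow> \<bar>huber_deriv c x\<bar> \<le> 2 * c"
  by (auto simp: huber_deriv_def)

lemma huber_bregman_eq:
  "\<bar>x\<bar> \<le> c \<Longrightarrow> \<bar>y\<bar> \<le> c \<Longrightarrow> huber c y - huber c x - huber_deriv c x * (y - x) = (y - x)\<^sup>2"
  by (auto simp: huber_def huber_deriv_def max_def min_def power2_eq_square algebra_simps abs_if split: if_splits)

text \<open>These lines are the tangents of \<open>huber c\<close> at the points of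
  \<open>[-c, c]\<close>. For \<open>\<bar>y\<bar> \<le> c\<close> the gap is
  \<open>(y - z)\<^sup>2\<close>; beyond \<open>c\<close> it is at least \<open>(c - \<bar>z\<bar>)
  * (2 * \<bar>y\<bar> - c - \<bar>z\<bar>)\<close>, a product of nonnegative factors.\<close>

lemma huber_tangent:
  assumes "\<bar>z\<bar> \<le> c" shows "2 * z * y - z\<^sup>2 \<le> huber c y"
proof (cases "\<bar>y\<bar> \<le> c")
  case True
  have "0 \<le> (y - z)\<^sup>2" by simp
  then show ?thesis using True by (simp add: huber_def power2_eq_square algebra_simps)
next
  case False
  have "z * y \<le> \<bar>z\<bar> * \<bar>y\<bar>" by (metis abs_ge_self abs_mult)
  moreover have "0 \<le> (c - \<bar>z\<bar>) * (2 * \<bar>y\<bar> - c - \<bar>z\<bar>)"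
    using assms False by (intro mult_nonneg_nonneg) auto
  then have "2 * (\<bar>z\<bar> * \<bar>y\<bar>) - \<bar>z\<bar> * \<bar>z\<bar> \<le> 2 * c * \<bar>y\<bar> - c * c"
    by (simp add: algebra_simps)
  ultimately show ?thesis
    using False by (simp add: huber_def power2_eq_square)
qed

text \<open>The tangent at \<open>x\<close> belongs to the family in \<open>huber_tangent\<close>,
  with \<open>z\<close> the projection of \<open>x\<close> onto \<open>[-c, c]\<close>, so convexity
  is obtained without differentiating.\<close>

lemma huber_bregman_nonneg:
  assumes "0 \<le> c"
  shows "0 \<le> huber c y - huber c x - huber_deriv c x * (y - x)"
proof -
  define z where "z = max (- c) (min c x)"
  have "huber c x = 2 * z * x - z\<^sup>2"
    using assms by (auto simp: z_def huber_def max_def min_def power2_eq_square)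
  moreover have "2 * z * y - z\<^sup>2 \<le> huber c y"
    using assms by (intro huber_tangent) (auto simp: z_def)
  ultimately show ?thesis
    by (simp add: huber_deriv_def z_def[symmetric] algebra_simps)
qed

lemma borel_measurable_huber [measurable]: "huber c \<in> borel_measurable borel"
  unfolding huber_def by measurable

lemma borel_measurable_huber_deriv [measurable]: "huber_deriv c \<in> borel_measurable borel"
  unfolding huber_deriv_def by measurable

lemma integrable_huber [simp]:
  assumes "0 \<le> c" "integrable M Y" shows "integrable M (\<lambda>\<omega>. huber c (Y \<omega>))"
proof (rule Bochner_Integration.integrable_bound)
  show "integrable M (\<lambda>\<omega>. 2 * c * \<bar>Y \<omega>\<bar>)" using assms by simp
  show "AE \<omega> in M. norm (huber c (Y \<omega>)) \<le> norm (2 * c * \<bar>Y \<omega>\<bar>)"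
    using assms huber_le[of c] huber_nonneg[of c] by (simp add: abs_mult)
qed (use assms in measurable)

subsection \<open>Integrals and limits\<close>

lemma integrable_bounded_mult:
  fixes Y Z :: "'a \<Rightarrow> real"
  assumes "integrable M Y" "Z \<in> borel_measurable M" "\<And>\<omega>. \<bar>Z \<omega>\<bar> \<le> K"
  shows "integrable M (\<lambda>\<omega>. Z \<omega> * Y \<omega>)"
proof (rule Bochner_Integration.integrable_bound)
  show "integrable M (\<lambda>\<omega>. K * Y \<omega>)" using assms(1) by simp
  have "\<bar>Z \<omega>\<bar> * \<bar>Y \<omega>\<bar> \<le> \<bar>K\<bar> * \<bar>Y \<omega>\<bar>" for \<omega>
    using assms(3)[of \<omega>] by (intro mult_right_mono) auto
  then show "AE \<omega> in M. norm (Z \<omega> * Y \<omega>) \<le> norm (K * Y \<omega>)"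
    by (simp add: abs_mult)
qed (use assms in measurable)

text \<open>If \<open>\<bar>d\<bar> \<le> \<eta>\<close> the first summand suffices, otherwise the
  second does. This turns control of a mean square into control of a mean absolute value.\<close>

lemma abs_le_add_square_divide: "0 < \<eta> \<Longrightarrow> \<bar>d\<bar> \<le> \<eta> + d\<^sup>2 / \<eta>" for d \<eta> :: real
proof -
  assume \<eta>: "0 < \<eta>"
  have "\<bar>d\<bar> * \<eta> \<le> \<eta> * \<eta> + d * d"
  proof (cases "\<bar>d\<bar> \<le> \<eta>")
    case True
    then show ?thesis using mult_right_mono[of "\<bar>d\<bar>" \<eta> \<eta>] \<eta> zero_le_square[of d] by linarith
  next
    case False
    then have "\<bar>d\<bar> * \<eta> \<le> \<bar>d\<bar> * \<bar>d\<bar>" by (intro mult_left_mono) auto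
    then show ?thesis using zero_le_square[of \<eta>] by (simp only: abs_mult_self_eq)
  qed
  then show ?thesis using \<eta> by (simp add: field_simps power2_eq_square)
qed

text \<open>Comparison with the single value \<open>f s\<close> is what a maximal inequality started
  at time \<open>s\<close> provides. The triangle inequality turns it into a Cauchy condition, and
  the limit is found along the integers.\<close>

lemma convergent_at_top_if_oscillation:
  fixes f :: "real \<Rightarrow> real"
  assumes f: "\<And>c. 0 < c \<Longrightarrow> \<exists>s. \<forall>t\<ge>s. \<bar>f t - f s\<bar> \<le> c"
  shows "\<exists>l. (f \<longlongrightarrow> l) at_top"
proof -
  have f2: "\<exists>s. \<forall>t\<ge>s. \<forall>u\<ge>s. \<bar>f t - f u\<bar> \<le> c" if c: "0 < c" for c
  proof -
    obtain s where s: "\<And>t. t \<ge> s \<Longrightarrow> \<bar>f t - f s\<bar> \<le> c / 2" using f[OF half_gt_zero[OF c]] by blast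
    have "\<bar>f t - f u\<bar> \<le> c" if "t \<ge> s" "u \<ge> s" for t u using s[OF that(1)] s[OF that(2)] by linarith
    then show ?thesis by blast
  qed
  have "Cauchy (\<lambda>n. f (real n))"
  proof (rule CauchyI)
    fix e :: real assume "0 < e"
    obtain s where s: "\<And>t u. t \<ge> s \<Longrightarrow> u \<ge> s \<Longrightarrow> \<bar>f t - f u\<bar> \<le> e / 2" using f2[OF half_gt_zero[OF \<open>0 < e\<close>]] by blast
    obtain N where N: "s \<le> real N" using real_arch_simple by blast
    have "norm (f (real m) - f (real n)) < e" if "m \<ge> N" "n \<ge> N" for m n
    proof -
      have "s \<le> real m" "s \<le> real n" using N that by linarith+
      then show ?thesis using s[of "real m" "real n"] \<open>0 < e\<close> by simp
    qed
    then show "\<exists>M. \<forall>m\<ge>M. \<forall>n\<ge>M. norm (f (real m) - f (real n)) < e" by blast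
  qed
  then obtain l where l: "(\<lambda>n. f (real n)) \<longlonglongrightarrow> l" by (auto simp: Cauchy_convergent_iff convergent_def)
  have "(f \<longlongrightarrow> l) at_top"
  proof (rule tendstoI)
    fix e :: real assume "0 < e"
    obtain s where s: "\<And>t u. t \<ge> s \<Longrightarrow> u \<ge> s \<Longrightarrow> \<bar>f t - f u\<bar> \<le> e / 2" using f2[OF half_gt_zero[OF \<open>0 < e\<close>]] by blast
    obtain N where N: "s \<le> real N" using real_arch_simple by blast
    have "dist (f t) l < e" if "t \<ge> s" for t
    proof -
      have "(\<lambda>n. \<bar>f t - f (real n)\<bar>) \<longlonglongrightarrow> \<bar>f t - l\<bar>" using l by (intro tendsto_intros)
      then have "\<bar>f t - l\<bar> \<le> e / 2"
        using s[OF that] N by (intro LIMSEQ_le_const2) (auto intro!: exI[of _ N])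
      then show ?thesis using \<open>0 < e\<close> by (simp add: dist_real_def)
    qed
    then show "\<forall>\<^sub>F t in at_top. dist (f t) l < e" unfolding eventually_at_top_linorder by blast
  qed
  then show ?thesis ..
qed

text \<open>The failure set of \<open>R\<close> may be non-measurable, so it is enclosed in a
  measurable null set: the intersection of the covers for \<open>e = 1/(n+1)\<close>.\<close>

lemma (in prob_space) AE_if_small_exceptional_sets:
  assumes "\<And>e. 0 < e \<Longrightarrow> \<exists>E\<in>sets M. prob E \<le> e \<and> {\<omega>\<in>space M. \<not> R \<omega>} \<subseteq> E"
  shows "AE \<omega> in M. R \<omega>"
proof -
  have "\<forall>n. \<exists>E\<in>sets M. prob E \<le> inverse (real (Suc n)) \<and> {\<omega>\<in>space M. \<not> R \<omega>} \<subseteq> E"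
    using assms by auto
  then obtain E where E: "\<And>n. E n \<in> sets M" "\<And>n. prob (E n) \<le> inverse (real (Suc n))"
    "\<And>n. {\<omega>\<in>space M. \<not> R \<omega>} \<subseteq> E n" by metis
  have I: "(\<Inter>n. E n) \<in> sets M" using E(1) by auto
  have "prob (\<Inter>n. E n) \<le> inverse (real (Suc n))" for n
    using finite_measure_mono[of "\<Inter>n. E n" "E n"] E(1,2)[of n] by (meson INT_lower UNIV_I order.trans)
  then have "prob (\<Inter>n. E n) \<le> 0"
    using LIMSEQ_le_const[OF LIMSEQ_inverse_real_of_nat] by blast
  then have "emeasure M (\<Inter>n. E n) = 0" by (simp add: emeasure_eq_measure ennreal_neg)
  then show ?thesis using E(3) I by (intro AE_I[of _ _ "\<Inter>n. E n"]) auto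
qed

subsection \<open>Square functions of discrete-time martingales\<close>

text \<open>The martingale property is encoded by bounded \<open>G i\<close>-measurable test
  functions \<open>Z\<close>. Below, \<open>Z\<close> is either a sign restricted to an event or the
  bounded derivative of the Huber function.\<close>

locale discrete_martingale = prob_space P for P :: "'a measure" +
  fixes G :: "nat \<Rightarrow> 'a measure" and f :: "nat \<Rightarrow> 'a \<Rightarrow> real"
  assumes subalg: "subalgebra P (G i)"
    and subalg_Suc: "subalgebra (G (Suc i)) (G i)"
    and adapted [measurable]: "f i \<in> borel_measurable (G i)"
    and integrable_f [simp]: "integrable P (f i)"
    and integral_mult_Suc: "Z \<in> borel_measurable (G i) \<Longrightarrow> (\<And>\<omega>. \<bar>Z \<omega>\<bar> \<le> K) \<Longrightarrow>
      (\<integral>\<omega>. Z \<omega> * f (Suc i) \<omega> \<partial>P) = (\<integral>\<omega>. Z \<omega> * f i \<omega> \<partial>P)"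
begin

lemma measurable_f [measurable]: "f i \<in> borel_measurable P"
  by (rule borel_measurable_integrable[OF integrable_f])

lemma measurable_G: "Z \<in> borel_measurable (G i) \<Longrightarrow> Z \<in> borel_measurable P"
  using measurable_from_subalg[OF subalg] by blast

lemma integral_mult_increment:
  assumes "Z \<in> borel_measurable (G i)" "\<And>\<omega>. \<bar>Z \<omega>\<bar> \<le> K"
  shows "(\<integral>\<omega>. Z \<omega> * (f (Suc i) \<omega> - f i \<omega>) \<partial>P) = 0"
    "integrable P (\<lambda>\<omega>. Z \<omega> * (f (Suc i) \<omega> - f i \<omega>))"
proof -
  note m = measurable_G[OF assms(1)]
  have i: "integrable P (\<lambda>\<omega>. Z \<omega> * f j \<omega>)" for j
    using integrable_bounded_mult[OF integrable_f m assms(2)] .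
  show "(\<integral>\<omega>. Z \<omega> * (f (Suc i) \<omega> - f i \<omega>) \<partial>P) = 0"
    using i integral_mult_Suc[OF assms] by (simp add: right_diff_distrib)
  show "integrable P (\<lambda>\<omega>. Z \<omega> * (f (Suc i) \<omega> - f i \<omega>))"
    using i by (simp add: right_diff_distrib)
qed

text \<open>This is the submartingale property of \<open>\<bar>f\<bar>\<close>. Testing with the
  sign of \<open>f i\<close> on \<open>A\<close> yields exactly \<open>\<bar>f i\<bar>\<close> on
  \<open>A\<close> at time \<open>i\<close>, and at most \<open>\<bar>f (Suc i)\<bar>\<close> on
  \<open>A\<close> one step later.\<close>

lemma integral_abs_indicator_mono:
  assumes A: "A \<in> sets (G i)"
  shows "(\<integral>\<omega>. indicator A \<omega> * \<bar>f i \<omega>\<bar> \<partial>P) \<le> (\<integral>\<omega>. indicator A \<omega> * \<bar>f (Suc i) \<omega>\<bar> \<partial>P)"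
proof -
  define Z :: "'a \<Rightarrow> real" where "Z = (\<lambda>\<omega>. indicator A \<omega> * sgn (f i \<omega>))"
  have Z: "Z \<in> borel_measurable (G i)" using A unfolding Z_def by measurable
  have b: "\<bar>Z \<omega>\<bar> \<le> 1" for \<omega> by (auto simp: Z_def indicator_def sgn_if)
  have AP: "A \<in> sets P" using A subalg by (auto simp: subalgebra_def)
  have "(\<integral>\<omega>. indicator A \<omega> * \<bar>f i \<omega>\<bar> \<partial>P) = (\<integral>\<omega>. Z \<omega> * f i \<omega> \<partial>P)"
    by (intro Bochner_Integration.integral_cong) (auto simp: Z_def abs_sgn)
  also have "\<dots> = (\<integral>\<omega>. Z \<omega> * f (Suc i) \<omega> \<partial>P)"
    by (rule integral_mult_Suc[OF Z b, symmetric])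
  also have "\<dots> \<le> (\<integral>\<omega>. indicator A \<omega> * \<bar>f (Suc i) \<omega>\<bar> \<partial>P)"
  proof (rule integral_mono)
    show "integrable P (\<lambda>\<omega>. Z \<omega> * f (Suc i) \<omega>)"
      by (rule integrable_bounded_mult[OF _ measurable_G[OF Z] b]) simp
    show "integrable P (\<lambda>\<omega>. indicator A \<omega> * \<bar>f (Suc i) \<omega>\<bar>)"
      using AP by (intro integrable_bounded_mult[where K=1]) (auto simp: indicator_def)
    show "Z \<omega> * f (Suc i) \<omega> \<le> indicator A \<omega> * \<bar>f (Suc i) \<omega>\<bar>" for \<omega>
      by (auto simp: Z_def indicator_def sgn_if)
  qed
  finally show ?thesis .
qed

lemma integral_abs_mono: "i \<le> j \<Longrightarrow> (\<integral>\<omega>. \<bar>f i \<omega>\<bar> \<partial>P) \<le> (\<integral>\<omega>. \<bar>f j \<omega>\<bar> \<partial>P)"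
proof (induction j rule: dec_induct)
  case (step n)
  have "(\<integral>\<omega>. indicator (space P) \<omega> * \<bar>f n \<omega>\<bar> \<partial>P) \<le> (\<integral>\<omega>. indicator (space P) \<omega> * \<bar>f (Suc n) \<omega>\<bar> \<partial>P)"
    using subalg[of n] by (intro integral_abs_indicator_mono) (metis sets.top subalgebra_def)
  then show ?case using step.IH
    by (simp add: indicator_def cong: Bochner_Integration.integral_cong)
qed simp

text \<open>Induction on \<open>k\<close> replaces a stopping time: the event at
  \<open>Suc k\<close> is the old event plus the outcomes that exceed \<open>c\<close> for the first
  time. The submartingale inequality moves the old part one step forward, and Markov's inequality
  handles the new part.\<close>

lemma doob_maximal:
  assumes c: "0 < c"
  shows "c * prob {\<omega>\<in>space P. \<exists>i\<le>k. c < \<bar>f i \<omega>\<bar>} \<le> (\<integral>\<omega>. \<bar>f k \<omega>\<bar> \<partial>P)"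
proof -
  define A where "A k = {\<omega>\<in>space P. \<exists>i\<le>k. c < \<bar>f i \<omega>\<bar>}" for k
  have sp: "space (G i) = space P" for i using subalg by (auto simp: subalgebra_def)
  have B: "{\<omega>\<in>space P. c < \<bar>f i \<omega>\<bar>} \<in> sets (G i)" for i
    unfolding sp[of i, symmetric] by measurable
  have A_Suc: "A (Suc k) = A k \<union> {\<omega>\<in>space P. c < \<bar>f (Suc k) \<omega>\<bar>}" for k
    by (auto simp: A_def le_Suc_eq)
  have A: "A k \<in> sets (G k)" for k
  proof (induction k)
    case 0 then show ?case using B[of 0] by (simp add: A_def)
  next
    case (Suc k)
    then have "A k \<in> sets (G (Suc k))" using subalg_Suc[of k] by (auto simp: subalgebra_def)
    then show ?case unfolding A_Suc using B by blast
  qed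
  have AP [measurable]: "A k \<in> sets P" for k using A[of k] subalg[of k] by (auto simp: subalgebra_def)
  have int: "integrable P (\<lambda>\<omega>. indicator S \<omega> * \<bar>f i \<omega>\<bar>)" if "S \<in> sets P" for S i
    using that by (intro integrable_bounded_mult[where K=1]) (auto simp: indicator_def)
  have markov: "c * prob S \<le> (\<integral>\<omega>. indicator S \<omega> * \<bar>f i \<omega>\<bar> \<partial>P)"
    if S: "S \<in> sets P" "\<And>\<omega>. \<omega> \<in> S \<Longrightarrow> c < \<bar>f i \<omega>\<bar>" for S i
  proof -
    have "c * prob S = (\<integral>\<omega>. c * indicator S \<omega> \<partial>P)" using S by simp
    also have "\<dots> \<le> (\<integral>\<omega>. indicator S \<omega> * \<bar>f i \<omega>\<bar> \<partial>P)"
    proof (rule integral_mono)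
      show "integrable P (\<lambda>\<omega>. c * indicator S \<omega>)" using S(1) by (simp add: less_top[symmetric])
      show "c * indicator S \<omega> \<le> indicator S \<omega> * \<bar>f i \<omega>\<bar>" for \<omega>
        using S(2)[of \<omega>] by (auto simp: indicator_def)
    qed (rule int[OF S(1)])
    finally show ?thesis .
  qed
  \<comment> \<open>Restricting the integral to \<open>A k\<close> strengthens the claim, so that in
    the induction step the contributions of the two disjoint parts add up to the integral over
    \<open>A (Suc k)\<close>.\<close>
  have main: "c * prob (A k) \<le> (\<integral>\<omega>. indicator (A k) \<omega> * \<bar>f k \<omega>\<bar> \<partial>P)"
  proof (induction k)
    case 0 show ?case by (rule markov) (auto simp: A_def)
  next
    case (Suc k)
    define D where "D = A (Suc k) - A k"
    have D [measurable]: "D \<in> sets P" unfolding D_def by measurable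
    have eq: "A (Suc k) = A k \<union> D" "A k \<inter> D = {}" by (auto simp: D_def A_Suc)
    have "c * prob (A (Suc k)) = c * prob (A k) + c * prob D"
      unfolding eq(1) using eq(2) by (subst finite_measure_Union) (auto simp: algebra_simps)
    also have "c * prob (A k) \<le> (\<integral>\<omega>. indicator (A k) \<omega> * \<bar>f (Suc k) \<omega>\<bar> \<partial>P)"
      using Suc.IH integral_abs_indicator_mono[OF A[of k]] by linarith
    also have "c * prob D \<le> (\<integral>\<omega>. indicator D \<omega> * \<bar>f (Suc k) \<omega>\<bar> \<partial>P)"
      by (rule markov) (auto simp: D_def A_Suc)
    also have "(\<integral>\<omega>. indicator (A k) \<omega> * \<bar>f (Suc k) \<omega>\<bar> \<partial>P) + (\<integral>\<omega>. indicator D \<omega> * \<bar>f (Suc k) \<omega>\<bar> \<partial>P)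
      = (\<integral>\<omega>. indicator (A (Suc k)) \<omega> * \<bar>f (Suc k) \<omega>\<bar> \<partial>P)"
      using eq by (subst Bochner_Integration.integral_add[symmetric, OF int int])
        (auto intro!: Bochner_Integration.integral_cong simp: indicator_def)
    finally show ?case by simp
  qed
  also have "\<dots> \<le> (\<integral>\<omega>. \<bar>f k \<omega>\<bar> \<partial>P)"
    by (rule integral_mono[OF int]) (auto simp: indicator_def)
  finally show ?thesis by (simp add: A_def)
qed

text \<open>\<open>D\<close> lies below the Bregman divergence \<open>R\<close>: they agree on the
  event, and off it \<open>D\<close> vanishes while \<open>R\<close> is nonnegative. The linear term
  of \<open>R\<close> has integral zero, which leaves the difference of the Huber means.\<close>

lemma huber_increment:
  fixes i :: nat
  assumes c: "0 \<le> c"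
  defines "D \<equiv> \<lambda>\<omega>. indicator {\<omega>. \<bar>f i \<omega>\<bar> \<le> c \<and> \<bar>f (Suc i) \<omega>\<bar> \<le> c} \<omega> * (f (Suc i) \<omega> - f i \<omega>)\<^sup>2"
  shows "integrable P D"
    "(\<integral>\<omega>. D \<omega> \<partial>P) \<le> (\<integral>\<omega>. huber c (f (Suc i) \<omega>) \<partial>P) - (\<integral>\<omega>. huber c (f i \<omega>) \<partial>P)"
proof -
  have "(\<lambda>\<omega>. huber_deriv c (f i \<omega>)) \<in> borel_measurable (G i)" by measurable
  note inc = integral_mult_increment[OF this huber_deriv_bound[OF c]]
  define R where "R = (\<lambda>\<omega>. huber c (f (Suc i) \<omega>) - huber c (f i \<omega>) - huber_deriv c (f i \<omega>) * (f (Suc i) \<omega> - f i \<omega>))"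
  have iR: "integrable P R"
    unfolding R_def using inc(2) c by (intro Bochner_Integration.integrable_diff) auto
  have DR: "D \<omega> \<le> R \<omega>" for \<omega>
    using huber_bregman_eq[of "f i \<omega>" c "f (Suc i) \<omega>"] huber_bregman_nonneg[OF c]
    by (auto simp: D_def R_def indicator_def)
  have D0: "0 \<le> D \<omega>" for \<omega> by (simp add: D_def)
  \<comment> \<open>The event inside \<open>D\<close> is not intersected with
    \<open>space P\<close>; the conditional form lets measurability follow from that of the
    functions.\<close>
  have D_eq: "D = (\<lambda>\<omega>. if \<bar>f i \<omega>\<bar> \<le> c \<and> \<bar>f (Suc i) \<omega>\<bar> \<le> c then (f (Suc i) \<omega> - f i \<omega>)\<^sup>2 else 0)"
    by (auto simp: D_def)
  have "D \<in> borel_measurable P" unfolding D_eq by measurable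
  moreover have "AE \<omega> in P. norm (D \<omega>) \<le> norm (R \<omega>)"
    using DR D0 order.trans[OF D0 DR] by auto
  ultimately show iD: "integrable P D"
    using Bochner_Integration.integrable_bound[OF iR] by blast
  have "(\<integral>\<omega>. D \<omega> \<partial>P) \<le> (\<integral>\<omega>. R \<omega> \<partial>P)" using iD iR DR by (rule integral_mono)
  also have "\<dots> = (\<integral>\<omega>. huber c (f (Suc i) \<omega>) \<partial>P) - (\<integral>\<omega>. huber c (f i \<omega>) \<partial>P)"
    unfolding R_def using inc c by simp
  finally show "(\<integral>\<omega>. D \<omega> \<partial>P) \<le> \<dots>" .
qed

text \<open>If all values up to \<open>k\<close> are bounded by \<open>c\<close>, then the square of
  \<open>f 0\<close> is its Huber value and each squared increment is \<open>D i\<close>; otherwise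
  the truncated sum is zero. The bounds on the means of the \<open>D i\<close> telescope.\<close>

lemma square_function_truncated:
  fixes k :: nat
  assumes c: "0 \<le> c"
  defines "S \<equiv> \<lambda>\<omega>. indicator {\<omega>\<in>space P. \<forall>i\<le>k. \<bar>f i \<omega>\<bar> \<le> c} \<omega> *
           ((f 0 \<omega>)\<^sup>2 + (\<Sum>i<k. (f (Suc i) \<omega> - f i \<omega>)\<^sup>2))"
  shows "integrable P S" "(\<integral>\<omega>. S \<omega> \<partial>P) \<le> (\<integral>\<omega>. huber c (f k \<omega>) \<partial>P)"
proof -
  define D where "D i \<omega> = indicator {\<omega>. \<bar>f i \<omega>\<bar> \<le> c \<and> \<bar>f (Suc i) \<omega>\<bar> \<le> c} \<omega> * (f (Suc i) \<omega> - f i \<omega>)\<^sup>2" for i \<omega>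
  have iD: "integrable P (D i)"
    and D: "(\<integral>\<omega>. D i \<omega> \<partial>P) \<le> (\<integral>\<omega>. huber c (f (Suc i) \<omega>) \<partial>P) - (\<integral>\<omega>. huber c (f i \<omega>) \<partial>P)" for i
    using huber_increment[OF c, of i] unfolding D_def[abs_def] by auto
  define R where "R = (\<lambda>\<omega>. huber c (f 0 \<omega>) + (\<Sum>i<k. D i \<omega>))"
  have iR: "integrable P R" unfolding R_def using c iD by auto
  have SR: "S \<omega> \<le> R \<omega>" for \<omega>
  proof (cases "\<omega> \<in> {\<omega>\<in>space P. \<forall>i\<le>k. \<bar>f i \<omega>\<bar> \<le> c}")
    case True
    then have "(\<Sum>i<k. (f (Suc i) \<omega> - f i \<omega>)\<^sup>2) = (\<Sum>i<k. D i \<omega>)"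
      by (intro sum.cong) (auto simp: D_def)
    then show ?thesis using True by (simp add: R_def S_def huber_def)
  next
    case False
    then show ?thesis
      by (auto simp: R_def S_def D_def intro!: add_nonneg_nonneg sum_nonneg huber_nonneg[OF c])
  qed
  have S0: "0 \<le> S \<omega>" for \<omega> by (auto simp: S_def intro!: mult_nonneg_nonneg add_nonneg_nonneg sum_nonneg)
  have "S \<in> borel_measurable P" unfolding S_def by measurable
  moreover have "AE \<omega> in P. norm (S \<omega>) \<le> norm (R \<omega>)"
    using SR S0 order.trans[OF S0 SR] by auto
  ultimately show iS: "integrable P S"
    using Bochner_Integration.integrable_bound[OF iR] by blast
  have "(\<integral>\<omega>. S \<omega> \<partial>P) \<le> (\<integral>\<omega>. R \<omega> \<partial>P)" using iS iR SR by (rule integral_mono)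
  also have "\<dots> = (\<integral>\<omega>. huber c (f 0 \<omega>) \<partial>P) + (\<Sum>i<k. \<integral>\<omega>. D i \<omega> \<partial>P)"
    unfolding R_def using c iD by simp
  also have "\<dots> \<le> (\<integral>\<omega>. huber c (f 0 \<omega>) \<partial>P) +
      (\<Sum>i<k. (\<integral>\<omega>. huber c (f (Suc i) \<omega>) \<partial>P) - (\<integral>\<omega>. huber c (f i \<omega>) \<partial>P))"
    by (intro add_left_mono sum_mono D)
  also have "\<dots> = (\<integral>\<omega>. huber c (f k \<omega>) \<partial>P)"
    using sum_lessThan_telescope[of "\<lambda>i. \<integral>\<omega>. huber c (f i \<omega>) \<partial>P" k] by simp
  finally show "(\<integral>\<omega>. S \<omega> \<partial>P) \<le> \<dots>" .
qed

text \<open>The constant 3 is 1 from Doob's inequality on the event \<open>A\<close>, plus 2 from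
  \<open>huber_le\<close> after Markov's inequality at level \<open>c\<^sup>2\<close> on the
  complementary event \<open>B\<close>.\<close>

lemma square_function_weak_type:
  assumes c: "0 < c"
  shows "c * prob {\<omega>\<in>space P. c\<^sup>2 < (f 0 \<omega>)\<^sup>2 + (\<Sum>i<k. (f (Suc i) \<omega> - f i \<omega>)\<^sup>2)} \<le> 3 * (\<integral>\<omega>. \<bar>f k \<omega>\<bar> \<partial>P)"
proof -
  define S where "S = (\<lambda>\<omega>. (f 0 \<omega>)\<^sup>2 + (\<Sum>i<k. (f (Suc i) \<omega> - f i \<omega>)\<^sup>2))"
  define A where "A = {\<omega>\<in>space P. \<exists>i\<le>k. c < \<bar>f i \<omega>\<bar>}"
  define B where "B = {\<omega>\<in>space P. \<forall>i\<le>k. \<bar>f i \<omega>\<bar> \<le> c}"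
  have [measurable]: "A \<in> sets P" "B \<in> sets P" "S \<in> borel_measurable P"
    unfolding A_def B_def S_def by measurable
  have S0: "0 \<le> S \<omega>" for \<omega> by (simp add: S_def sum_nonneg)
  have int: "integrable P (\<lambda>\<omega>. indicator B \<omega> * S \<omega>)"
    and le: "(\<integral>\<omega>. indicator B \<omega> * S \<omega> \<partial>P) \<le> (\<integral>\<omega>. huber c (f k \<omega>) \<partial>P)"
    using square_function_truncated[of c k] c by (simp_all add: B_def S_def)
  have "{\<omega>\<in>space P. c\<^sup>2 < S \<omega>} \<subseteq> A \<union> {\<omega>\<in>space P. c\<^sup>2 \<le> indicator B \<omega> * S \<omega>}"
    by (auto simp: A_def B_def indicator_def not_less)
  then have "prob {\<omega>\<in>space P. c\<^sup>2 < S \<omega>} \<le> prob A + prob {\<omega>\<in>space P. c\<^sup>2 \<le> indicator B \<omega> * S \<omega>}"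
    by (intro order.trans[OF finite_measure_mono measure_Un_le]) measurable
  then have "c * prob {\<omega>\<in>space P. c\<^sup>2 < S \<omega>} \<le> c * prob A + c * prob {\<omega>\<in>space P. c\<^sup>2 \<le> indicator B \<omega> * S \<omega>}"
    using c by (simp add: distrib_left[symmetric])
  moreover have "c * prob A \<le> (\<integral>\<omega>. \<bar>f k \<omega>\<bar> \<partial>P)"
    unfolding A_def by (rule doob_maximal[OF c])
  moreover have "c * prob {\<omega>\<in>space P. c\<^sup>2 \<le> indicator B \<omega> * S \<omega>} \<le> 2 * (\<integral>\<omega>. \<bar>f k \<omega>\<bar> \<partial>P)"
  proof -
    have "prob {\<omega>\<in>space P. c\<^sup>2 \<le> indicator B \<omega> * S \<omega>} \<le> (\<integral>\<omega>. indicator B \<omega> * S \<omega> \<partial>P) / c\<^sup>2"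
      using c S0 by (intro integral_Markov_inequality_measure[OF int]) auto
    also have "\<dots> \<le> (\<integral>\<omega>. huber c (f k \<omega>) \<partial>P) / c\<^sup>2"
      using le by (intro divide_right_mono) auto
    also have "\<dots> \<le> (\<integral>\<omega>. 2 * c * \<bar>f k \<omega>\<bar> \<partial>P) / c\<^sup>2"
      using c by (intro divide_right_mono integral_mono huber_le) auto
    finally have "c * prob {\<omega>\<in>space P. c\<^sup>2 \<le> indicator B \<omega> * S \<omega>} \<le> c * ((\<integral>\<omega>. 2 * c * \<bar>f k \<omega>\<bar> \<partial>P) / c\<^sup>2)"
      using c by (intro mult_left_mono) auto
    also have "\<dots> = 2 * (\<integral>\<omega>. \<bar>f k \<omega>\<bar> \<partial>P)" using c by (simp add: power2_eq_square)
    finally show ?thesis .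
  qed
  ultimately show ?thesis by (simp add: S_def)
qed

end

subsection \<open>Uniformly integrable martingales\<close>

context filtered_prob_space
begin

section \<open>From continuous time to discrete grids\<close>

lemma martingale_integral_mult:
  assumes X: "martingale P F X" and st: "0 \<le> s" "s \<le> t"
    and Z: "Z \<in> borel_measurable (F s)" "\<And>\<omega>. \<bar>Z \<omega>\<bar> \<le> K"
  shows "(\<integral>\<omega>. Z \<omega> * X t \<omega> \<partial>P) = (\<integral>\<omega>. Z \<omega> * X s \<omega> \<partial>P)"
proof -
  interpret finite_measure_subalgebra P "F s"
    using subalgebra_filtration[OF st(1)] by unfold_locales
  have ZP [measurable]: "Z \<in> borel_measurable P" using measurable_from_subalg[OF subalg Z(1)] .
  have Xt: "integrable P (X t)" "integrable P (X s)" using X st by (auto simp: martingale_def)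
  have "integrable P (\<lambda>\<omega>. Z \<omega> * X t \<omega>)" by (rule integrable_bounded_mult[OF Xt(1) ZP Z(2)])
  then have "(\<integral>\<omega>. Z \<omega> * X t \<omega> \<partial>P) = (\<integral>\<omega>. Z \<omega> * real_cond_exp P (F s) (X t) \<omega> \<partial>P)"
    using Z(1) Xt by (intro real_cond_exp_intg(2)[symmetric]) auto
  also have "\<dots> = (\<integral>\<omega>. Z \<omega> * X s \<omega> \<partial>P)"
  proof (rule Bochner_Integration.integral_cong_AE)
    have "AE \<omega> in P. real_cond_exp P (F s) (X t) \<omega> = X s \<omega>"
      using X st by (auto simp: martingale_def)
    then show "AE \<omega> in P. Z \<omega> * real_cond_exp P (F s) (X t) \<omega> = Z \<omega> * X s \<omega>" by auto
  qed (use Xt in measurable)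
  finally show ?thesis .
qed

lemma martingale_diff:
  assumes X: "martingale P F X" and Y: "martingale P F Y"
  shows "martingale P F (\<lambda>t \<omega>. X t \<omega> - Y t \<omega>)"
  unfolding martingale_def
proof (intro conjI allI impI)
  fix t :: real assume "0 \<le> t"
  then show "(\<lambda>\<omega>. X t \<omega> - Y t \<omega>) \<in> borel_measurable (F t)" "integrable P (\<lambda>\<omega>. X t \<omega> - Y t \<omega>)"
    using X Y by (auto simp: martingale_def intro!: borel_measurable_diff)
next
  fix s t :: real assume st: "0 \<le> s" "s \<le> t"
  interpret finite_measure_subalgebra P "F s"
    using subalgebra_filtration[OF st(1)] by unfold_locales
  have "AE \<omega> in P. real_cond_exp P (F s) (\<lambda>\<omega>. X t \<omega> - Y t \<omega>) \<omega> =
      real_cond_exp P (F s) (X t) \<omega> - real_cond_exp P (F s) (Y t) \<omega>"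
    using X Y st by (intro real_cond_exp_diff) (auto simp: martingale_def)
  moreover have "AE \<omega> in P. real_cond_exp P (F s) (X t) \<omega> = X s \<omega>"
    "AE \<omega> in P. real_cond_exp P (F s) (Y t) \<omega> = Y s \<omega>"
    using X Y st by (auto simp: martingale_def)
  ultimately show "AE \<omega> in P. real_cond_exp P (F s) (\<lambda>\<omega>. X t \<omega> - Y t \<omega>) \<omega> = X s \<omega> - Y s \<omega>"
    by eventually_elim simp
qed

text \<open>Subtracting \<open>Y\<close> serves to restart the martingale at time \<open>s\<close>
  with \<open>Y = X s\<close>; plain sampling is the case \<open>Y = 0\<close>. The grid is only
  required to be nondecreasing, so grids with repeated times are covered.\<close>

lemma discrete_martingale_sampled:
  assumes X: "martingale P F X" and p: "0 \<le> p 0" "\<And>i. p i \<le> p (Suc i)"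
    and Y: "Y \<in> borel_measurable (F (p 0))" "integrable P Y"
  shows "discrete_martingale P (\<lambda>i. F (p i)) (\<lambda>i \<omega>. X (p i) \<omega> - Y \<omega>)"
proof -
  have mono: "p 0 \<le> p i" for i using lift_Suc_mono_le[of p 0 i] p(2) by simp
  have nn: "0 \<le> p i" for i using mono[of i] p(1) by linarith
  have Yi: "Y \<in> borel_measurable (F (p i))" for i
    using measurable_from_subalg[OF filtration_mono[OF p(1) mono] Y(1)] .
  have iX: "integrable P (X (p i))" for i using X nn by (auto simp: martingale_def)
  show ?thesis
  proof
    fix i Z and K :: real
    show "subalgebra P (F (p i))" using subalgebra_filtration[OF nn] .
    show "subalgebra (F (p (Suc i))) (F (p i))" using filtration_mono[OF nn p(2)] .
    show "(\<lambda>\<omega>. X (p i) \<omega> - Y \<omega>) \<in> borel_measurable (F (p i))"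
      using X nn Yi by (intro borel_measurable_diff) (auto simp: martingale_def)
    show "integrable P (\<lambda>\<omega>. X (p i) \<omega> - Y \<omega>)" using iX Y(2) by simp
    assume Z: "Z \<in> borel_measurable (F (p i))" "\<And>\<omega>. \<bar>Z \<omega>\<bar> \<le> K"
    have int: "integrable P (\<lambda>\<omega>. Z \<omega> * V \<omega>)" if V: "integrable P V" for V :: "'a \<Rightarrow> real"
    proof (rule integrable_bounded_mult[OF V _ Z(2)])
      show "Z \<in> borel_measurable P" using measurable_from_subalg[OF subalgebra_filtration[OF nn] Z(1)] .
    qed
    show "(\<integral>\<omega>. Z \<omega> * (X (p (Suc i)) \<omega> - Y \<omega>) \<partial>P) = (\<integral>\<omega>. Z \<omega> * (X (p i) \<omega> - Y \<omega>) \<partial>P)"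
      using martingale_integral_mult[OF X nn p(2) Z] int[OF iX] int[OF Y(2)]
      by (simp add: right_diff_distrib)
  qed
qed

text \<open>Two times are extended to a sequence that stays at \<open>t\<close> from index 1 on, so
  that the discrete results apply to a single increment.\<close>

lemma discrete_martingale_pair:
  assumes X: "martingale P F X" and st: "0 \<le> s" "s \<le> t"
  shows "discrete_martingale P (\<lambda>i. F (if i = 0 then s else t)) (\<lambda>i. X (if i = 0 then s else t))"
proof -
  have "discrete_martingale P (\<lambda>i. F (if i = 0 then s else t)) (\<lambda>i \<omega>. X (if i = 0 then s else t) \<omega> - 0)"
    by (rule discrete_martingale_sampled[OF X]) (use st in auto)
  then show ?thesis by (simp only: diff_0_right)
qed

lemma martingale_integral_abs_mono:
  assumes "martingale P F X" "0 \<le> s" "s \<le> t"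
  shows "(\<integral>\<omega>. \<bar>X s \<omega>\<bar> \<partial>P) \<le> (\<integral>\<omega>. \<bar>X t \<omega>\<bar> \<partial>P)"
proof -
  interpret discrete_martingale P "\<lambda>i. F (if i = 0 then s else t)" "\<lambda>i. X (if i = 0 then s else t)"
    by (rule discrete_martingale_pair[OF assms])
  show ?thesis using integral_abs_mono[of 0 1] by simp
qed

lemma martingale_huber_increment:
  assumes "martingale P F X" "0 \<le> s" "s \<le> t" "0 \<le> c"
  defines "D \<equiv> \<lambda>\<omega>. indicator {\<omega>. \<bar>X s \<omega>\<bar> \<le> c \<and> \<bar>X t \<omega>\<bar> \<le> c} \<omega> * (X t \<omega> - X s \<omega>)\<^sup>2"
  shows "integrable P D"
    "(\<integral>\<omega>. D \<omega> \<partial>P) \<le> (\<integral>\<omega>. huber c (X t \<omega>) \<partial>P) - (\<integral>\<omega>. huber c (X s \<omega>) \<partial>P)"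
proof -
  interpret discrete_martingale P "\<lambda>i. F (if i = 0 then s else t)" "\<lambda>i. X (if i = 0 then s else t)"
    by (rule discrete_martingale_pair[OF assms(1-3)])
  show "integrable P D"
    "(\<integral>\<omega>. D \<omega> \<partial>P) \<le> (\<integral>\<omega>. huber c (X t \<omega>) \<partial>P) - (\<integral>\<omega>. huber c (X s \<omega>) \<partial>P)"
    using huber_increment[OF assms(4), of 0] by (simp_all add: D_def)
qed

section \<open>Cauchy property in L1\<close>

lemma UI_martingale_L1_Cauchy:
  assumes X: "X \<in> UI_martingales P F" and \<epsilon>: "0 < \<epsilon>"
  shows "\<exists>s\<ge>0. \<forall>t\<ge>s. (\<integral>\<omega>. \<bar>X t \<omega> - X s \<omega>\<bar> \<partial>P) \<le> \<epsilon>"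
proof -
  have mX: "martingale P F X" and ui: "unif_integrable P X" using X by (auto simp: UI_martingales_def)
  \<comment> \<open>Six shares: one for the constant, one for the integral of
    \<open>D / \<eta>\<close>, and two for each of the two tails.\<close>
  define \<eta> where "\<eta> = \<epsilon> / 6"
  have \<eta>: "0 < \<eta>" using \<epsilon> by (simp add: \<eta>_def)
  obtain K0 where K0: "\<And>t. 0 \<le> t \<Longrightarrow> (LINT \<omega>:{\<omega>\<in>space P. K0 < \<bar>X t \<omega>\<bar>}|P. \<bar>X t \<omega>\<bar>) \<le> \<eta>"
    using ui \<eta> unfolding unif_integrable_def by blast
  \<comment> \<open>Raising the level only shrinks the tails, and it makes \<open>K\<close>
    positive.\<close>
  define K where "K = max K0 1"
  have K: "0 < K" by (simp add: K_def)
  define T where "T t \<omega> = indicator {\<omega>\<in>space P. K < \<bar>X t \<omega>\<bar>} \<omega> * \<bar>X t \<omega>\<bar>" for t \<omega>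
  have iX [simp]: "integrable P (X t)" if "0 \<le> t" for t using mX that by (auto simp: martingale_def)
  have iT [simp]: "integrable P (T t)" if "0 \<le> t" for t
    unfolding T_def using iX[OF that]
    by (intro integrable_bounded_mult[where K=1]) (auto simp: indicator_def)
  have T: "(\<integral>\<omega>. T t \<omega> \<partial>P) \<le> \<eta>" if "0 \<le> t" for t
  proof -
    have "(\<integral>\<omega>. T t \<omega> \<partial>P) \<le> (\<integral>\<omega>. indicator {\<omega>\<in>space P. K0 < \<bar>X t \<omega>\<bar>} \<omega> * \<bar>X t \<omega>\<bar> \<partial>P)"
    proof (rule integral_mono)
      show "integrable P (\<lambda>\<omega>. indicator {\<omega>\<in>space P. K0 < \<bar>X t \<omega>\<bar>} \<omega> * \<bar>X t \<omega>\<bar>)"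
        using iX[OF that] by (intro integrable_bounded_mult[where K=1]) (auto simp: indicator_def)
    qed (use that in simp, auto simp: T_def K_def indicator_def)
    also have "\<dots> \<le> \<eta>" using K0[OF that] by (simp add: set_lebesgue_integral_def)
    finally show ?thesis .
  qed
  define H where "H t = (\<integral>\<omega>. huber K (X t \<omega>) \<partial>P)" for t
  have H_le: "H t \<le> 2 * K * (K + \<eta>)" if "0 \<le> t" for t
  proof -
    have "(\<integral>\<omega>. \<bar>X t \<omega>\<bar> \<partial>P) \<le> (\<integral>\<omega>. K + T t \<omega> \<partial>P)"
    proof (rule integral_mono)
      show "\<bar>X t \<omega>\<bar> \<le> K + T t \<omega>" if "\<omega> \<in> space P" for \<omega>
        using that K by (auto simp: T_def indicator_def)
    qed (use that in auto)
    also have "\<dots> \<le> K + \<eta>" using T[OF that] that by (simp add: prob_space)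
    finally have "2 * K * (\<integral>\<omega>. \<bar>X t \<omega>\<bar> \<partial>P) \<le> 2 * K * (K + \<eta>)" using K by simp
    moreover have "H t \<le> (\<integral>\<omega>. 2 * K * \<bar>X t \<omega>\<bar> \<partial>P)"
      unfolding H_def using K that by (intro integral_mono integrable_huber huber_le) auto
    ultimately show ?thesis by simp
  qed
  have bdd: "bdd_above (H ` {0..})" using H_le by (auto intro!: bdd_aboveI2)
  \<comment> \<open>At a time \<open>s\<close> where \<open>H\<close> is within
    \<open>\<eta>\<^sup>2\<close> of its supremum, no later time can increase \<open>H\<close> by
    more than \<open>\<eta>\<^sup>2\<close>, which bounds the integral of \<open>D\<close>.\<close>
  have "Sup (H ` {0..}) - \<eta>\<^sup>2 < Sup (H ` {0..})" using \<eta> by simp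
  then obtain s where s: "0 \<le> s" "Sup (H ` {0..}) - \<eta>\<^sup>2 < H s"
    using bdd by (subst (asm) less_cSup_iff) auto
  have "(\<integral>\<omega>. \<bar>X t \<omega> - X s \<omega>\<bar> \<partial>P) \<le> \<epsilon>" if st: "s \<le> t" for t
  proof -
    have t: "0 \<le> t" using st s by simp
    define D where "D = (\<lambda>\<omega>. indicator {\<omega>. \<bar>X s \<omega>\<bar> \<le> K \<and> \<bar>X t \<omega>\<bar> \<le> K} \<omega> * (X t \<omega> - X s \<omega>)\<^sup>2)"
    have D: "integrable P D" "(\<integral>\<omega>. D \<omega> \<partial>P) \<le> H t - H s"
      using martingale_huber_increment[OF mX s(1) st, of K] K by (auto simp: D_def H_def)
    have "H t \<le> Sup (H ` {0..})" using bdd t by (intro cSup_upper) auto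
    then have D2: "(\<integral>\<omega>. D \<omega> \<partial>P) / \<eta> \<le> \<eta>"
      using D(2) s(2) \<eta> by (simp add: divide_le_eq power2_eq_square)
    \<comment> \<open>If both values are at most \<open>K\<close>,
      \<open>abs_le_add_square_divide\<close> applies. If only one exceeds \<open>K\<close>, it
      dominates the other, so the difference is at most twice that tail; hence the factors
      2.\<close>
    have "(\<integral>\<omega>. \<bar>X t \<omega> - X s \<omega>\<bar> \<partial>P) \<le> (\<integral>\<omega>. \<eta> + D \<omega> / \<eta> + 2 * T t \<omega> + 2 * T s \<omega> \<partial>P)"
    proof (rule integral_mono)
      show "integrable P (\<lambda>\<omega>. \<bar>X t \<omega> - X s \<omega>\<bar>)" using s t by simp
      show "integrable P (\<lambda>\<omega>. \<eta> + D \<omega> / \<eta> + 2 * T t \<omega> + 2 * T s \<omega>)" using s t D by simp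
      fix \<omega> assume "\<omega> \<in> space P"
      then show "\<bar>X t \<omega> - X s \<omega>\<bar> \<le> \<eta> + D \<omega> / \<eta> + 2 * T t \<omega> + 2 * T s \<omega>"
        using abs_le_add_square_divide[OF \<eta>, of "X t \<omega> - X s \<omega>"] \<eta>
        by (auto simp: D_def T_def indicator_def)
    qed
    also have "\<dots> = \<eta> + (\<integral>\<omega>. D \<omega> \<partial>P) / \<eta> + 2 * (\<integral>\<omega>. T t \<omega> \<partial>P) + 2 * (\<integral>\<omega>. T s \<omega> \<partial>P)"
      using s t D by (simp add: prob_space)
    also have "\<dots> \<le> \<epsilon>" using D2 T[OF t] T[OF s(1)] by (simp add: \<eta>_def)
    finally show ?thesis .
  qed
  then show ?thesis using s(1) by blast
qed

section \<open>Maximal inequality in continuous time and almost sure convergence\<close>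

lemma martingale_oscillation:
  assumes X: "martingale P F X" and cad: "cadlag_on (space P) X" and s: "0 \<le> s" and c: "0 < c"
    and \<delta>: "\<And>t. s \<le> t \<Longrightarrow> (\<integral>\<omega>. \<bar>X t \<omega> - X s \<omega>\<bar> \<partial>P) \<le> \<delta>"
  shows "\<exists>E\<in>sets P. prob E \<le> \<delta> / c \<and> {\<omega>\<in>space P. \<exists>t\<ge>s. c < \<bar>X t \<omega> - X s \<omega>\<bar>} \<subseteq> E"
proof -
  \<comment> \<open>The grid with step \<open>1 / 2 ^ m\<close> and \<open>4 ^ m\<close> intervals
    reaches \<open>s + 2 ^ m\<close>, so it refines and exhausts the half-line at once. The union of
    the events \<open>A m\<close> is a measurable cover of the event over uncountably many
    times.\<close>
  define q where "q m i = s + real i / 2 ^ m" for m i :: nat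
  define A where "A m = {\<omega>\<in>space P. \<exists>i\<le>4^m. c < \<bar>X (q m i) \<omega> - X s \<omega>\<bar>}" for m :: nat
  have q_ge: "s \<le> q m i" for m i by (simp add: q_def)
  have mX: "X t \<in> borel_measurable P" if "s \<le> t" for t
    using X s that by (intro borel_measurable_integrable) (auto simp: martingale_def)
  have A [measurable]: "A m \<in> sets P" for m
    unfolding A_def using mX[OF q_ge] mX[OF order.refl] by measurable
  have "prob (A m) \<le> \<delta> / c" for m
  proof -
    interpret D: discrete_martingale P "\<lambda>i. F (q m i)" "\<lambda>i \<omega>. X (q m i) \<omega> - X s \<omega>"
      using s X by (intro discrete_martingale_sampled[OF X])
        (auto simp: q_def divide_right_mono martingale_def)
    have "c * prob (A m) \<le> (\<integral>\<omega>. \<bar>X (q m (4^m)) \<omega> - X s \<omega>\<bar> \<partial>P)"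
      unfolding A_def by (rule D.doob_maximal[OF c])
    also have "\<dots> \<le> \<delta>" by (rule \<delta>[OF q_ge])
    finally show ?thesis using c by (simp add: field_simps)
  qed
  moreover have "(\<lambda>m. prob (A m)) \<longlonglongrightarrow> prob (\<Union>m. A m)"
  proof (rule finite_Lim_measure_incseq)
    show "incseq A"
    proof (rule incseq_SucI, rule subsetI)
      fix m \<omega> assume "\<omega> \<in> A m"
      then obtain i where i: "\<omega> \<in> space P" "i \<le> 4 ^ m" "c < \<bar>X (q m i) \<omega> - X s \<omega>\<bar>" by (auto simp: A_def)
      have "q m i = q (Suc m) (2 * i)" by (simp add: q_def)
      moreover have "2 * i \<le> 4 ^ Suc m" using i(2) by simp
      ultimately show "\<omega> \<in> A (Suc m)" using i unfolding A_def by fastforce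
    qed
  qed auto
  ultimately have "prob (\<Union>m. A m) \<le> \<delta> / c" by (intro LIMSEQ_le_const2) auto
  moreover have "{\<omega>\<in>space P. \<exists>t\<ge>s. c < \<bar>X t \<omega> - X s \<omega>\<bar>} \<subseteq> (\<Union>m. A m)"
  proof
    fix \<omega> assume "\<omega> \<in> {\<omega>\<in>space P. \<exists>t\<ge>s. c < \<bar>X t \<omega> - X s \<omega>\<bar>}"
    then obtain t where t: "\<omega> \<in> space P" "s \<le> t" "c < \<bar>X t \<omega> - X s \<omega>\<bar>" by auto
    have "((\<lambda>u. X u \<omega>) \<longlongrightarrow> X t \<omega>) (at_right t)" using cad t s by (auto simp: cadlag_on_def)
    then have "((\<lambda>u. \<bar>X u \<omega> - X s \<omega>\<bar>) \<longlongrightarrow> \<bar>X t \<omega> - X s \<omega>\<bar>) (at_right t)" by (intro tendsto_intros)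
    then have "\<forall>\<^sub>F u in at_right t. c < \<bar>X u \<omega> - X s \<omega>\<bar>" using t(3) by (rule order_tendstoD)
    then obtain b where b: "t < b" "\<And>u. t < u \<Longrightarrow> u < b \<Longrightarrow> c < \<bar>X u \<omega> - X s \<omega>\<bar>"
      unfolding eventually_at_right_field by blast
    \<comment> \<open>The first bound on \<open>2 ^ m\<close> keeps the grid time just after
      \<open>t\<close> in range; the second makes the step smaller than
      \<open>b - t\<close>.\<close>
    obtain m :: nat where m: "max (t - s + 1) (1 / (b - t)) < 2 ^ m"
      using real_arch_pow[of 2 "max (t - s + 1) (1 / (b - t))"] by auto
    \<comment> \<open>The first grid index strictly after \<open>t\<close>: right-continuity gives
      information only to the right of \<open>t\<close>.\<close>
    define i where "i = Suc (nat \<lfloor>(t - s) * 2 ^ m\<rfloor>)"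
    have nn: "0 \<le> (t - s) * 2 ^ m" using t by simp
    then have i: "(t - s) * 2 ^ m < real i" "real i \<le> (t - s) * 2 ^ m + 1"
      by (simp_all add: i_def) linarith+
    have "(t - s) * 2 ^ m + 1 \<le> (t - s + 1) * 2 ^ m" by (simp add: distrib_right)
    also have "\<dots> \<le> 2 ^ m * 2 ^ m" using m by (intro mult_right_mono) auto
    also have "\<dots> = real (4 ^ m)" by (simp add: power_mult_distrib[symmetric])
    finally have "i \<le> 4 ^ m" using i(2) by linarith
    moreover have "t < q m i" using i(1) by (simp add: q_def field_simps)
    moreover have "1 < (b - t) * 2 ^ m" using m b(1) by (simp add: field_simps)
    then have "q m i < b" using i(2) by (simp add: q_def field_simps)
    ultimately show "\<omega> \<in> (\<Union>m. A m)" using b(2)[of "q m i"] t(1) unfolding A_def by auto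
  qed
  ultimately show ?thesis by (intro bexI[of _ "\<Union>m. A m"]) auto
qed

lemma UI_martingale_AE_convergent:
  assumes X: "X \<in> UI_martingales P F"
  shows "AE \<omega> in P. \<exists>l. ((\<lambda>t. X t \<omega>) \<longlongrightarrow> l) at_top"
proof -
  have mX: "martingale P F X" and cad: "cadlag_on (space P) X" using X by (auto simp: UI_martingales_def)
  have "AE \<omega> in P. \<exists>s. \<forall>t\<ge>s. \<bar>X t \<omega> - X s \<omega>\<bar> \<le> c" if c: "0 < c" for c
  proof (rule AE_if_small_exceptional_sets)
    fix e :: real assume e: "0 < e"
    \<comment> \<open>The tolerance is \<open>e * c\<close> because the maximal inequality divides
      by \<open>c\<close>.\<close>
    obtain s where s: "0 \<le> s" "\<And>t. s \<le> t \<Longrightarrow> (\<integral>\<omega>. \<bar>X t \<omega> - X s \<omega>\<bar> \<partial>P) \<le> e * c"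
      using UI_martingale_L1_Cauchy[OF X, of "e * c"] e c by auto
    obtain E where "E \<in> sets P" "prob E \<le> e * c / c" "{\<omega>\<in>space P. \<exists>t\<ge>s. c < \<bar>X t \<omega> - X s \<omega>\<bar>} \<subseteq> E"
      using martingale_oscillation[OF mX cad s(1) c s(2)] by blast
    then show "\<exists>E\<in>sets P. prob E \<le> e \<and> {\<omega>\<in>space P. \<not> (\<exists>s. \<forall>t\<ge>s. \<bar>X t \<omega> - X s \<omega>\<bar> \<le> c)} \<subseteq> E"
      using c by (intro bexI[of _ E]) (auto simp: not_le)
  qed
  \<comment> \<open>Only countably many null sets may be united, so \<open>c\<close> runs through
    \<open>1/(j+1)\<close>.\<close>
  then have "AE \<omega> in P. \<forall>j. \<exists>s. \<forall>t\<ge>s. \<bar>X t \<omega> - X s \<omega>\<bar> \<le> inverse (real (Suc j))"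
    by (simp add: AE_all_countable)
  then show ?thesis
  proof eventually_elim
    case (elim \<omega>)
    show ?case
    proof (rule convergent_at_top_if_oscillation)
      fix c :: real assume "0 < c"
      then obtain j where "inverse (real (Suc j)) < c" using reals_Archimedean by blast
      then show "\<exists>s. \<forall>t\<ge>s. \<bar>X t \<omega> - X s \<omega>\<bar> \<le> c" using elim by (meson less_imp_le order.trans)
    qed
  qed
qed

section \<open>The terminal value as an L1 limit\<close>

lemma UI_martingale_terminal_value:
  assumes X: "X \<in> UI_martingales P F"
  shows "\<exists>Y. integrable P Y \<and> (AE \<omega> in P. terminal_value X \<omega> = Y \<omega>) \<and>
    (\<forall>\<epsilon>>0. \<exists>s\<ge>0. \<forall>t\<ge>s. (\<integral>\<omega>. \<bar>X t \<omega> - Y \<omega>\<bar> \<partial>P) \<le> \<epsilon>)"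
proof -
  have iX: "integrable P (X t)" if "0 \<le> t" for t
    using X that by (auto simp: UI_martingales_def martingale_def)
  \<comment> \<open>The limit along the integers is measurable as a limit of a sequence, and it
    agrees almost surely with the limit over real times in \<open>terminal_value\<close>.\<close>
  define Y where "Y \<omega> = lim (\<lambda>n. X (real n) \<omega>)" for \<omega>
  have [measurable]: "X (real n) \<in> borel_measurable P" for n using iX by simp
  have [measurable]: "Y \<in> borel_measurable P" unfolding Y_def by measurable
  have lim: "AE \<omega> in P. terminal_value X \<omega> = Y \<omega> \<and> (\<lambda>n. X (real n) \<omega>) \<longlonglongrightarrow> Y \<omega>"
    using UI_martingale_AE_convergent[OF X]
  proof eventually_elim
    case (elim \<omega>)
    then obtain l where l: "((\<lambda>t. X t \<omega>) \<longlongrightarrow> l) at_top" ..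
    have "(\<lambda>n. X (real n) \<omega>) \<longlonglongrightarrow> l" by (rule filterlim_compose[OF l filterlim_real_sequentially])
    moreover have "terminal_value X \<omega> = l"
      unfolding terminal_value_def using l by (intro tendsto_Lim) auto
    ultimately show ?case by (simp add: Y_def limI)
  qed
  \<comment> \<open>Both \<open>X t\<close> and every late \<open>X (real n)\<close> lie within
    \<open>\<epsilon> / 2\<close> of \<open>X s\<close> in L1, hence within
    \<open>\<epsilon>\<close> of each other; Fatou's lemma carries this bound over to
    \<open>Y\<close>.\<close>
  have fatou: "integrable P (\<lambda>\<omega>. X t \<omega> - Y \<omega>)" "(\<integral>\<omega>. \<bar>X t \<omega> - Y \<omega>\<bar> \<partial>P) \<le> \<epsilon>"
    if s: "0 \<le> s" "\<And>u. s \<le> u \<Longrightarrow> (\<integral>\<omega>. \<bar>X u \<omega> - X s \<omega>\<bar> \<partial>P) \<le> \<epsilon> / 2" and t: "s \<le> t" for s t \<epsilon>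
  proof -
    have [measurable]: "X t \<in> borel_measurable P" using iX[of t] s t by simp
    have \<epsilon>: "0 \<le> \<epsilon>" using s(2)[of s] by simp
    have *: "(\<integral>\<^sup>+\<omega>. ennreal \<bar>X t \<omega> - X (real n) \<omega>\<bar> \<partial>P) \<le> ennreal \<epsilon>" if n: "s \<le> real n" for n
    proof -
      have i: "integrable P (X t)" "integrable P (X s)" "integrable P (X (real n))"
        using s t n by (auto intro!: iX)
      have "(\<integral>\<omega>. \<bar>X t \<omega> - X (real n) \<omega>\<bar> \<partial>P) \<le> (\<integral>\<omega>. \<bar>X t \<omega> - X s \<omega>\<bar> + \<bar>X (real n) \<omega> - X s \<omega>\<bar> \<partial>P)"
        using i by (intro integral_mono) auto
      also have "\<dots> \<le> \<epsilon>" using s(2)[OF t] s(2)[OF n] i by simp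
      finally show ?thesis using i by (subst nn_integral_eq_integral) (auto intro: ennreal_leI)
    qed
    have "(\<integral>\<^sup>+\<omega>. ennreal \<bar>X t \<omega> - Y \<omega>\<bar> \<partial>P) = (\<integral>\<^sup>+\<omega>. liminf (\<lambda>n. ennreal \<bar>X t \<omega> - X (real n) \<omega>\<bar>) \<partial>P)"
    proof (rule nn_integral_cong_AE)
      show "AE \<omega> in P. ennreal \<bar>X t \<omega> - Y \<omega>\<bar> = liminf (\<lambda>n. ennreal \<bar>X t \<omega> - X (real n) \<omega>\<bar>)"
        using lim
      proof eventually_elim
        case (elim \<omega>)
        then have "(\<lambda>n. ennreal \<bar>X t \<omega> - X (real n) \<omega>\<bar>) \<longlonglongrightarrow> ennreal \<bar>X t \<omega> - Y \<omega>\<bar>"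
          by (intro tendsto_intros) auto
        then show ?case by (intro lim_imp_Liminf[symmetric]) auto
      qed
    qed
    also have "\<dots> \<le> liminf (\<lambda>n. \<integral>\<^sup>+\<omega>. ennreal \<bar>X t \<omega> - X (real n) \<omega>\<bar> \<partial>P)"
      by (rule nn_integral_liminf) measurable
    also have "\<dots> \<le> ennreal \<epsilon>"
    proof (rule Liminf_le)
      obtain N where N: "s \<le> real N" using real_arch_simple by blast
      have "s \<le> real n" if "N \<le> n" for n using N that by linarith
      then show "\<forall>\<^sub>F n in sequentially. (\<integral>\<^sup>+\<omega>. ennreal \<bar>X t \<omega> - X (real n) \<omega>\<bar> \<partial>P) \<le> ennreal \<epsilon>"
        unfolding eventually_sequentially using * by blast
    qed simp
    finally have le: "(\<integral>\<^sup>+\<omega>. ennreal \<bar>X t \<omega> - Y \<omega>\<bar> \<partial>P) \<le> ennreal \<epsilon>" .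
    then show i: "integrable P (\<lambda>\<omega>. X t \<omega> - Y \<omega>)"
      by (intro integrableI_bounded) (auto intro: order.strict_trans1)
    show "(\<integral>\<omega>. \<bar>X t \<omega> - Y \<omega>\<bar> \<partial>P) \<le> \<epsilon>"
      using le i \<epsilon> by (subst (asm) nn_integral_eq_integral) auto
  qed
  have Cauchy: "\<exists>s\<ge>0. \<forall>u\<ge>s. (\<integral>\<omega>. \<bar>X u \<omega> - X s \<omega>\<bar> \<partial>P) \<le> \<epsilon> / 2" if "0 < \<epsilon>" for \<epsilon>
    using UI_martingale_L1_Cauchy[OF X half_gt_zero[OF that]] .
  obtain s where s: "0 \<le> s" "\<And>u. s \<le> u \<Longrightarrow> (\<integral>\<omega>. \<bar>X u \<omega> - X s \<omega>\<bar> \<partial>P) \<le> 1 / 2"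
    using Cauchy[of 1] by auto
  have "integrable P (\<lambda>\<omega>. X s \<omega> - (X s \<omega> - Y \<omega>))"
    using iX[OF s(1)] fatou(1)[OF s order.refl] by (rule Bochner_Integration.integrable_diff)
  then have "integrable P Y" by simp
  moreover have "\<exists>s\<ge>0. \<forall>t\<ge>s. (\<integral>\<omega>. \<bar>X t \<omega> - Y \<omega>\<bar> \<partial>P) \<le> \<epsilon>" if "0 < \<epsilon>" for \<epsilon>
    using Cauchy[OF that] fatou(2) by blast
  ultimately show ?thesis using lim by (intro exI[of _ Y]) auto
qed

text \<open>The L1 norm of the martingale difference is nondecreasing in time, and at late times it
  is arbitrarily close to that of \<open>Y - Y'\<close>, the integrable versions of the terminal
  values.\<close>

lemma UI_martingale_diff_integral_le:
  assumes X: "X \<in> UI_martingales P F" and X': "X' \<in> UI_martingales P F" and t: "0 \<le> t"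
  shows "ennreal (\<integral>\<omega>. \<bar>X t \<omega> - X' t \<omega>\<bar> \<partial>P) \<le> (\<integral>\<^sup>+\<omega>. ennreal \<bar>terminal_value X \<omega> - terminal_value X' \<omega>\<bar> \<partial>P)"
proof -
  obtain Y where Y: "integrable P Y" "AE \<omega> in P. terminal_value X \<omega> = Y \<omega>"
    "\<And>\<epsilon>. 0 < \<epsilon> \<Longrightarrow> \<exists>s\<ge>0. \<forall>t\<ge>s. (\<integral>\<omega>. \<bar>X t \<omega> - Y \<omega>\<bar> \<partial>P) \<le> \<epsilon>"
    using UI_martingale_terminal_value[OF X] by blast
  obtain Y' where Y': "integrable P Y'" "AE \<omega> in P. terminal_value X' \<omega> = Y' \<omega>"
    "\<And>\<epsilon>. 0 < \<epsilon> \<Longrightarrow> \<exists>s\<ge>0. \<forall>t\<ge>s. (\<integral>\<omega>. \<bar>X' t \<omega> - Y' \<omega>\<bar> \<partial>P) \<le> \<epsilon>"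
    using UI_martingale_terminal_value[OF X'] by blast
  have mart: "martingale P F X" "martingale P F X'" using X X' by (auto simp: UI_martingales_def)
  have iX: "integrable P (X u)" "integrable P (X' u)" if "0 \<le> u" for u
    using mart that by (auto simp: martingale_def)
  have "(\<integral>\<omega>. \<bar>X t \<omega> - X' t \<omega>\<bar> \<partial>P) \<le> (\<integral>\<omega>. \<bar>Y \<omega> - Y' \<omega>\<bar> \<partial>P)"
  proof (rule field_le_epsilon)
    fix e :: real assume e: "0 < e"
    obtain s where s: "0 \<le> s" "\<And>t. s \<le> t \<Longrightarrow> (\<integral>\<omega>. \<bar>X t \<omega> - Y \<omega>\<bar> \<partial>P) \<le> e / 2"
      using Y(3)[OF half_gt_zero[OF e]] by blast
    obtain s' where s': "0 \<le> s'" "\<And>t. s' \<le> t \<Longrightarrow> (\<integral>\<omega>. \<bar>X' t \<omega> - Y' \<omega>\<bar> \<partial>P) \<le> e / 2"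
      using Y'(3)[OF half_gt_zero[OF e]] by blast
    define u where "u = max t (max s s')"
    have u: "0 \<le> u" "t \<le> u" "s \<le> u" "s' \<le> u" using t by (auto simp: u_def)
    have "(\<integral>\<omega>. \<bar>X t \<omega> - X' t \<omega>\<bar> \<partial>P) \<le> (\<integral>\<omega>. \<bar>X u \<omega> - X' u \<omega>\<bar> \<partial>P)"
      using martingale_integral_abs_mono[OF martingale_diff[OF mart] t u(2)] .
    also have "\<dots> \<le> (\<integral>\<omega>. \<bar>Y \<omega> - Y' \<omega>\<bar> + \<bar>X u \<omega> - Y \<omega>\<bar> + \<bar>X' u \<omega> - Y' \<omega>\<bar> \<partial>P)"
      using iX[OF u(1)] Y(1) Y'(1) by (intro integral_mono) auto
    also have "\<dots> = (\<integral>\<omega>. \<bar>Y \<omega> - Y' \<omega>\<bar> \<partial>P) + (\<integral>\<omega>. \<bar>X u \<omega> - Y \<omega>\<bar> \<partial>P) + (\<integral>\<omega>. \<bar>X' u \<omega> - Y' \<omega>\<bar> \<partial>P)"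
      using iX[OF u(1)] Y(1) Y'(1) by simp
    also have "\<dots> \<le> (\<integral>\<omega>. \<bar>Y \<omega> - Y' \<omega>\<bar> \<partial>P) + e" using s(2)[OF u(3)] s'(2)[OF u(4)] by linarith
    finally show "(\<integral>\<omega>. \<bar>X t \<omega> - X' t \<omega>\<bar> \<partial>P) \<le> (\<integral>\<omega>. \<bar>Y \<omega> - Y' \<omega>\<bar> \<partial>P) + e" .
  qed
  then have "ennreal (\<integral>\<omega>. \<bar>X t \<omega> - X' t \<omega>\<bar> \<partial>P) \<le> ennreal (\<integral>\<omega>. \<bar>Y \<omega> - Y' \<omega>\<bar> \<partial>P)" by (rule ennreal_leI)
  also have "\<dots> = (\<integral>\<^sup>+\<omega>. ennreal \<bar>Y \<omega> - Y' \<omega>\<bar> \<partial>P)"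
    using Y(1) Y'(1) by (intro nn_integral_eq_integral[symmetric]) auto
  also have "\<dots> = (\<integral>\<^sup>+\<omega>. ennreal \<bar>terminal_value X \<omega> - terminal_value X' \<omega>\<bar> \<partial>P)"
  proof (rule nn_integral_cong_AE)
    show "AE \<omega> in P. ennreal \<bar>Y \<omega> - Y' \<omega>\<bar> = ennreal \<bar>terminal_value X \<omega> - terminal_value X' \<omega>\<bar>"
      using Y(2) Y'(2) by eventually_elim simp
  qed
  finally show ?thesis .
qed

subsection \<open>Quadratic variation\<close>

lemma quadratic_variation_weak_type:
  assumes N: "martingale P F N" and Q: "is_quadratic_variation P N Q" and t: "0 \<le> t" and \<epsilon>: "0 < \<epsilon>"
  shows "prob {\<omega>\<in>space P. \<epsilon> < \<bar>Q t \<omega>\<bar>} \<le> 3 * (\<integral>\<omega>. \<bar>N t \<omega>\<bar> \<partial>P) / sqrt (\<epsilon> / 2)"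
proof -
  \<comment> \<open>Partition points increase strictly, so \<open>[0,0]\<close> admits only the
    partition without intervals; for \<open>t > 0\<close> the grid is equidistant.\<close>
  define k where "k m = (if t = 0 then 0 else Suc m)" for m :: nat
  define p where "p m i = t * real i / real (Suc m)" for m i :: nat
  define S where "S m = square_sum N (k m) (p m)" for m
  have step: "p m (Suc i) - p m i = t / real (Suc m)" for m i
    by (simp add: p_def diff_divide_distrib[symmetric] algebra_simps)
  have p0: "p m 0 = 0" and pk: "p m (k m) = t" for m by (simp_all add: p_def k_def)
  have p_mono: "p m i \<le> p m (Suc i)" for m i using step[of m i] t by (smt (verit) divide_nonneg_nonneg of_nat_0_le_iff)
  have p_nn: "0 \<le> p m i" for m i using t by (simp add: p_def)
  have part: "partition_of t (k m) (p m)" for m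
  proof -
    have "p m i < p m (Suc i)" if "i < k m" for i
    proof -
      have "t > 0" using that t by (auto simp: k_def split: if_splits)
      then have "0 < t / real (Suc m)" by simp
      then show ?thesis using step[of m i] by linarith
    qed
    then show ?thesis using p0 pk by (simp add: partition_of_def)
  qed
  have mesh: "(\<lambda>m. mesh (k m) (p m)) \<longlonglongrightarrow> 0"
  proof (rule tendsto_sandwich)
    show "\<forall>\<^sub>F m in sequentially. 0 \<le> mesh (k m) (p m)" by (simp add: mesh_def)
    show "\<forall>\<^sub>F m in sequentially. mesh (k m) (p m) \<le> t / real (Suc m)"
      using t by (simp add: mesh_def step)
    show "(\<lambda>m. t / real (Suc m)) \<longlonglongrightarrow> 0"
      using tendsto_mult_right_zero[OF LIMSEQ_inverse_real_of_nat, of t] by (simp add: field_simps)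
  qed simp
  have conv: "tendsto_in_prob P (\<lambda>m \<omega>. ereal (S m \<omega>)) (Q t)"
    using Q t part mesh unfolding is_quadratic_variation_def S_def by blast
  have [measurable]: "N (p m i) \<in> borel_measurable P" "N 0 \<in> borel_measurable P" for m i
    using N p_nn by (auto simp: martingale_def)
  have [measurable]: "S m \<in> borel_measurable P" for m unfolding S_def square_sum_def[abs_def] by measurable
  have [measurable]: "Q t \<in> borel_measurable P" using conv by (simp add: tendsto_in_prob_def)
  \<comment> \<open>Half of \<open>\<epsilon>\<close> is spent on the approximation error and half
    on the size of the sums; this is the origin of \<open>sqrt (\<epsilon> / 2)\<close>.\<close>
  define a where "a m = prob {\<omega>\<in>space P. \<epsilon> / 2 < \<bar>S m \<omega> - Q t \<omega>\<bar>}" for m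
  have a: "a \<longlonglongrightarrow> 0"
    using conv \<epsilon> unfolding tendsto_in_prob_def a_def[abs_def] by (auto dest: spec[of _ "\<epsilon> / 2"])
  define C where "C = 3 * (\<integral>\<omega>. \<bar>N t \<omega>\<bar> \<partial>P) / sqrt (\<epsilon> / 2)"
  have S_le: "prob {\<omega>\<in>space P. \<epsilon> / 2 < S m \<omega>} \<le> C" for m
  proof -
    have "discrete_martingale P (\<lambda>i. F (p m i)) (\<lambda>i \<omega>. N (p m i) \<omega> - 0)"
      by (rule discrete_martingale_sampled[OF N]) (use p_nn p_mono in auto)
    then interpret D: discrete_martingale P "\<lambda>i. F (p m i)" "\<lambda>i. N (p m i)"
      by (simp only: diff_0_right)
    have "sqrt (\<epsilon> / 2) * prob {\<omega>\<in>space P. (sqrt (\<epsilon> / 2))\<^sup>2 < S m \<omega>} \<le> 3 * (\<integral>\<omega>. \<bar>N t \<omega>\<bar> \<partial>P)"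
      using D.square_function_weak_type[of "sqrt (\<epsilon> / 2)" "k m"] \<epsilon> by (simp add: S_def square_sum_def p0 pk)
    then show ?thesis using \<epsilon> by (simp add: C_def field_simps)
  qed
  have "prob {\<omega>\<in>space P. \<epsilon> < \<bar>Q t \<omega>\<bar>} \<le> a m + C" for m
  proof -
    have "0 \<le> S m \<omega>" for \<omega> by (simp add: S_def square_sum_def sum_nonneg)
    \<comment> \<open>Since \<open>S m\<close> is nonnegative, \<open>\<bar>Q t\<bar>\<close> is at
      most \<open>\<bar>S m - Q t\<bar> + S m\<close>.\<close>
    then have "{\<omega>\<in>space P. \<epsilon> < \<bar>Q t \<omega>\<bar>} \<subseteq> {\<omega>\<in>space P. \<epsilon> / 2 < \<bar>S m \<omega> - Q t \<omega>\<bar>} \<union> {\<omega>\<in>space P. \<epsilon> / 2 < S m \<omega>}"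
      by (smt (verit) Un_iff field_sum_of_halves mem_Collect_eq subsetI)
    then have "prob {\<omega>\<in>space P. \<epsilon> < \<bar>Q t \<omega>\<bar>} \<le> a m + prob {\<omega>\<in>space P. \<epsilon> / 2 < S m \<omega>}"
      unfolding a_def by (intro order.trans[OF finite_measure_mono measure_Un_le]) measurable
    then show ?thesis using S_le[of m] by linarith
  qed
  moreover have "(\<lambda>m. a m + C) \<longlonglongrightarrow> 0 + C" by (intro tendsto_intros a)
  ultimately have "prob {\<omega>\<in>space P. \<epsilon> < \<bar>Q t \<omega>\<bar>} \<le> 0 + C" by (intro LIMSEQ_le_const) auto
  then show ?thesis by (simp add: C_def)
qed

end

section \<open>Quadratic variation at infinity\<close>

lemma qv_infinity_eq_SUP:
  assumes mono: "mono_on {0..} (\<lambda>t. Q t \<omega>)"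
  shows "qv_infinity Q \<omega> = (SUP n. ereal (Q (real n) \<omega>))" (is "_ = ?S")
proof -
  have le: "ereal (Q t \<omega>) \<le> ?S" if "0 \<le> t" for t
  proof -
    obtain n where "t \<le> real n" using real_arch_simple by blast
    then have "ereal (Q t \<omega>) \<le> ereal (Q (real n) \<omega>)" using mono_onD[OF mono, of t "real n"] that by auto
    also have "\<dots> \<le> ?S" by (rule SUP_upper) simp
    finally show ?thesis .
  qed
  have "((\<lambda>t. ereal (Q t \<omega>)) \<longlongrightarrow> ?S) at_top"
  proof (rule order_tendstoI)
    fix a assume "a < ?S"
    then obtain n where n: "a < ereal (Q (real n) \<omega>)" by (auto simp: less_SUP_iff)
    have "a < ereal (Q t \<omega>)" if "real n \<le> t" for t
      using n mono_onD[OF mono, of "real n" t] that by (auto intro: order.strict_trans2)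
    then show "\<forall>\<^sub>F t in at_top. a < ereal (Q t \<omega>)" unfolding eventually_at_top_linorder by blast
  next
    fix a assume "?S < a"
    then have "ereal (Q t \<omega>) < a" if "0 \<le> t" for t using le[OF that] by (rule order.strict_trans1[rotated])
    then show "\<forall>\<^sub>F t in at_top. ereal (Q t \<omega>) < a" unfolding eventually_at_top_linorder by blast
  qed
  then show ?thesis unfolding qv_infinity_def by (intro tendsto_Lim) auto
qed

context prob_space
begin

lemma borel_measurable_qv_infinity:
  assumes "is_quadratic_variation M X Q"
  shows "qv_infinity Q \<in> borel_measurable M"
proof -
  have [measurable]: "Q (real n) \<in> borel_measurable M" for n
    using assms by (auto simp: is_quadratic_variation_def)
  have "(\<lambda>\<omega>. SUP n. ereal (Q (real n) \<omega>)) \<in> borel_measurable M" by measurable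
  then show ?thesis
    using assms by (subst measurable_cong[OF qv_infinity_eq_SUP]) (auto simp: is_quadratic_variation_def)
qed

text \<open>The factor 2 accounts for both signs. Values above \<open>\<epsilon>\<close> are already
  exceeded by some \<open>Q (real n)\<close>, through increasing events; a value below
  \<open>-\<epsilon>\<close> forces \<open>Q 0\<close> below \<open>-\<epsilon>\<close> by
  monotonicity.\<close>

lemma prob_qv_infinity_le:
  assumes Q: "is_quadratic_variation M X Q"
    and C: "\<And>t. 0 \<le> t \<Longrightarrow> prob {\<omega>\<in>space M. \<epsilon> < \<bar>Q t \<omega>\<bar>} \<le> C"
  shows "prob {\<omega>\<in>space M. ereal \<epsilon> < \<bar>qv_infinity Q \<omega>\<bar>} \<le> 2 * C"
proof -
  have mono: "mono_on {0..} (\<lambda>t. Q t \<omega>)" if "\<omega> \<in> space M" for \<omega>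
    using Q that by (auto simp: is_quadratic_variation_def)
  have Qm [measurable]: "Q (real n) \<in> borel_measurable M" for n
    using Q by (auto simp: is_quadratic_variation_def)
  have Q0 [measurable]: "Q 0 \<in> borel_measurable M" using Qm[of 0] by simp
  define A where "A n = {\<omega>\<in>space M. \<epsilon> < Q (real n) \<omega>}" for n
  define B where "B = {\<omega>\<in>space M. \<epsilon> < \<bar>Q 0 \<omega>\<bar>}"
  have [measurable]: "A n \<in> sets M" "B \<in> sets M" for n unfolding A_def B_def by measurable
  have "(\<lambda>n. prob (A n)) \<longlonglongrightarrow> prob (\<Union>n. A n)"
  proof (rule finite_Lim_measure_incseq)
    show "incseq A"
    proof (rule incseq_SucI, rule subsetI)
      fix n \<omega> assume "\<omega> \<in> A n"
      then show "\<omega> \<in> A (Suc n)"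
        using mono_onD[OF mono, of \<omega> "real n" "real (Suc n)"] by (auto simp: A_def)
    qed
  qed auto
  moreover have "prob (A n) \<le> C" for n
  proof -
    have "prob (A n) \<le> prob {\<omega>\<in>space M. \<epsilon> < \<bar>Q (real n) \<omega>\<bar>}"
      unfolding A_def by (intro finite_measure_mono) auto
    then show ?thesis using C[of "real n"] by simp
  qed
  ultimately have U: "prob (\<Union>n. A n) \<le> C" by (intro LIMSEQ_le_const2) auto
  have "{\<omega>\<in>space M. ereal \<epsilon> < \<bar>qv_infinity Q \<omega>\<bar>} \<subseteq> B \<union> (\<Union>n. A n)"
  proof
    fix \<omega> assume "\<omega> \<in> {\<omega>\<in>space M. ereal \<epsilon> < \<bar>qv_infinity Q \<omega>\<bar>}"
    then have \<omega>: "\<omega> \<in> space M" "ereal \<epsilon> < \<bar>SUP n. ereal (Q (real n) \<omega>)\<bar>"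
      using qv_infinity_eq_SUP[of Q \<omega>, OF mono] by auto
    show "\<omega> \<in> B \<union> (\<Union>n. A n)"
    proof (cases "ereal \<epsilon> < (SUP n. ereal (Q (real n) \<omega>))")
      case True
      then show ?thesis using \<omega>(1) by (auto simp: less_SUP_iff A_def)
    next
      case False
      have "ereal (Q 0 \<omega>) \<le> (SUP n. ereal (Q (real n) \<omega>))" by (rule SUP_upper2[of 0]) auto
      also have "\<dots> < - ereal \<epsilon>"
        using False \<omega>(2) by (cases "SUP n. ereal (Q (real n) \<omega>)") (auto simp: abs_if split: if_splits)
      finally show ?thesis using \<omega>(1) by (auto simp: B_def)
    qed
  qed
  then have "prob {\<omega>\<in>space M. ereal \<epsilon> < \<bar>qv_infinity Q \<omega>\<bar>} \<le> prob B + prob (\<Union>n. A n)"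
    by (intro order.trans[OF finite_measure_mono measure_Un_le]) measurable
  then show ?thesis using U C[of 0] by (simp add: B_def)
qed

end

section \<open>Convergence in probability, at infinity and at fixed times\<close>

theorem lemma3p1:
  fixes P :: "'a measure" and F :: "real \<Rightarrow> 'a measure"
    and Mn :: "nat \<Rightarrow> real \<Rightarrow> 'a \<Rightarrow> real" and M :: "real \<Rightarrow> 'a \<Rightarrow> real"
    and Q :: "nat \<Rightarrow> real \<Rightarrow> 'a \<Rightarrow> real"
  assumes "filtered_prob_space P F"
    and "\<And>n. Mn n \<in> UI_martingales P F"
    and "M \<in> UI_martingales P F"
    and "\<And>n. is_quadratic_variation P (\<lambda>t \<omega>. Mn n t \<omega> - M t \<omega>) (Q n)"
    and "tendsto_L1 P (\<lambda>n. terminal_value (Mn n)) (terminal_value M)"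
  shows "tendsto_in_prob P (\<lambda>n. qv_infinity (Q n)) (\<lambda>_. 0) \<and>
         (\<forall>t\<ge>0. tendsto_in_prob P (\<lambda>n \<omega>. ereal (Q n t \<omega>)) (\<lambda>_. 0))"
proof -
  interpret filtered_prob_space P F by fact
  have mart: "martingale P F (\<lambda>t \<omega>. Mn n t \<omega> - M t \<omega>)" for n
    using assms(2,3) by (intro martingale_diff) (auto simp: UI_martingales_def)
  define e where "e n = (\<integral>\<^sup>+\<omega>. ennreal \<bar>terminal_value (Mn n) \<omega> - terminal_value M \<omega>\<bar> \<partial>P)" for n
  have e: "e \<longlonglongrightarrow> 0" using assms(5) by (simp add: tendsto_L1_def e_def[abs_def])
  \<comment> \<open>\<open>enn2real\<close> sends \<open>\<infinity>\<close> to 0, so it represents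
    \<open>e n\<close> faithfully only where \<open>e n\<close> is finite; convergence to 0 ensures
    this for all large \<open>n\<close>.\<close>
  have "\<forall>\<^sub>F n in sequentially. e n < \<infinity>" using order_tendstoD(2)[OF e, of \<infinity>] by simp
  then have fin: "\<forall>\<^sub>F n in sequentially. ennreal (enn2real (e n)) = e n" by eventually_elim simp
  have "(\<lambda>n. enn2real (e n)) \<longlonglongrightarrow> enn2real 0" using e by (intro tendsto_enn2real) auto
  then have e_real: "(\<lambda>n. enn2real (e n)) \<longlonglongrightarrow> 0" by simp
  \<comment> \<open>The bound is uniform in \<open>t\<close>, which allows passing to
    \<open>qv_infinity\<close>.\<close>
  have bound: "\<forall>\<^sub>F n in sequentially. \<forall>t\<ge>0. prob {\<omega>\<in>space P. \<epsilon> < \<bar>Q n t \<omega>\<bar>} \<le> 3 * enn2real (e n) / sqrt (\<epsilon> / 2)"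
    if \<epsilon>: "0 < \<epsilon>" for \<epsilon>
    using fin
  proof eventually_elim
    case (elim n)
    show ?case
    proof (intro allI impI)
      fix t :: real assume t: "0 \<le> t"
      have "(\<integral>\<omega>. \<bar>Mn n t \<omega> - M t \<omega>\<bar> \<partial>P) \<le> enn2real (e n)"
        using UI_martingale_diff_integral_le[OF assms(2,3) t, of n] elim
        by (simp add: e_def[symmetric] flip: ennreal_le_iff)
      then have "3 * (\<integral>\<omega>. \<bar>Mn n t \<omega> - M t \<omega>\<bar> \<partial>P) / sqrt (\<epsilon> / 2) \<le> 3 * enn2real (e n) / sqrt (\<epsilon> / 2)"
        using \<epsilon> by (intro divide_right_mono mult_left_mono) auto
      then show "prob {\<omega>\<in>space P. \<epsilon> < \<bar>Q n t \<omega>\<bar>} \<le> 3 * enn2real (e n) / sqrt (\<epsilon> / 2)"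
        using quadratic_variation_weak_type[OF mart assms(4) t \<epsilon>] by (rule order.trans[rotated])
    qed
  qed
  \<comment> \<open>The factor \<open>c\<close> is 2 at infinity, from
    \<open>prob_qv_infinity_le\<close>, and 1 at a fixed time.\<close>
  have lim: "(\<lambda>n. c * (3 * enn2real (e n) / sqrt (\<epsilon> / 2))) \<longlonglongrightarrow> 0" for c \<epsilon> :: real
    using e_real by (intro tendsto_mult_right_zero tendsto_divide_zero)
  have "tendsto_in_prob P (\<lambda>n. qv_infinity (Q n)) (\<lambda>_. 0)"
    unfolding tendsto_in_prob_def
  proof (intro conjI allI impI)
    show "qv_infinity (Q n) \<in> borel_measurable P" for n by (rule borel_measurable_qv_infinity[OF assms(4)])
    fix \<epsilon> :: real assume "0 < \<epsilon>"
    have "\<forall>\<^sub>F n in sequentially. prob {\<omega>\<in>space P. ereal \<epsilon> < \<bar>qv_infinity (Q n) \<omega> - ereal 0\<bar>}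
        \<le> 2 * (3 * enn2real (e n) / sqrt (\<epsilon> / 2))"
      using bound[OF \<open>0 < \<epsilon>\<close>]
    proof eventually_elim
      case (elim n)
      then have "prob {\<omega>\<in>space P. ereal \<epsilon> < \<bar>qv_infinity (Q n) \<omega>\<bar>} \<le> 2 * (3 * enn2real (e n) / sqrt (\<epsilon> / 2))"
        by (intro prob_qv_infinity_le[OF assms(4)]) auto
      then show ?case by simp
    qed
    then show "(\<lambda>n. prob {\<omega>\<in>space P. ereal \<epsilon> < \<bar>qv_infinity (Q n) \<omega> - ereal 0\<bar>}) \<longlonglongrightarrow> 0"
      by (rule tendsto_sandwich[OF always_eventually _ tendsto_const lim, rotated]) simp
  qed simp
  moreover have "tendsto_in_prob P (\<lambda>n \<omega>. ereal (Q n t \<omega>)) (\<lambda>_. 0)" if t: "0 \<le> t" for t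
    unfolding tendsto_in_prob_def
  proof (intro conjI allI impI)
    show "(\<lambda>\<omega>. ereal (Q n t \<omega>)) \<in> borel_measurable P" for n
      using assms(4)[of n] t by (auto simp: is_quadratic_variation_def)
    fix \<epsilon> :: real assume "0 < \<epsilon>"
    have "\<forall>\<^sub>F n in sequentially. prob {\<omega>\<in>space P. ereal \<epsilon> < \<bar>ereal (Q n t \<omega>) - ereal 0\<bar>}
        \<le> 1 * (3 * enn2real (e n) / sqrt (\<epsilon> / 2))"
      using bound[OF \<open>0 < \<epsilon>\<close>] by eventually_elim (use t in auto)
    then show "(\<lambda>n. prob {\<omega>\<in>space P. ereal \<epsilon> < \<bar>ereal (Q n t \<omega>) - ereal 0\<bar>}) \<longlonglongrightarrow> 0"
      by (rule tendsto_sandwich[OF always_eventually _ tendsto_const lim, rotated]) simp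
  qed simp
  ultimately show ?thesis by blast
qed

end
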